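(* Let $ABC$ be a triangle, and let $\mathcal{H}$ be the Jerabek hyperbola of the mid-arc triangle of $ABC$. Then the conic $\mathcal{H}$ is rectangular and passes through the circumcenter of $ABC$, the incenter of $ABC$, the midpoint of the segment joining the mittenpunkt and the incenter of $ABC$, the Schiffler point of $ABC$, and the isogonal conjugate, with respect to the mid-arc triangle, of the Bevan point of $ABC$.
   Context: The mid-arc triangle of $ABC$ is the triangle whose vertices are the midpoints of the arcs $BC$, $CA$, $AB$ of the circumcircle of $ABC$ not containing the opposite vertices. The Jerabek hyperbola of a triangle is the hyperbola passing through its vertices, circumcenter, orthocenter, Lemoine (symmedian) point, and the isogonal conjugate of its de Longchamps point (the reflection of the orthocenter in the circumcenter). The mittenpunkt of $ABC$ is the Lemoine point of its excentral triangle (the triangle of its excenters); the Bevan point of $ABC$ is the circumcenter of its excentral triangle. The Schiffler point of $ABC$ with incenter $I$ is the common point of the Euler lines of the triangles $ABC$, $IBC$, $ICA$, $IAB$. *)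

theory Defs
  imports "HOL-Analysis.Analysis"
begin

abbreviation line :: "real^2 \<Rightarrow> real^2 \<Rightarrow> (real^2) set" where
  "line P Q \<equiv> affine hull {P, Q}"

definition circumcenter :: "real^2 \<Rightarrow> real^2 \<Rightarrow> real^2 \<Rightarrow> real^2" where
  "circumcenter A B C = (THE P. dist P A = dist P B \<and> dist P A = dist P C)"

definition orthocenter :: "real^2 \<Rightarrow> real^2 \<Rightarrow> real^2 \<Rightarrow> real^2" where
  "orthocenter A B C =
     (THE P. orthogonal (P - A) (B - C) \<and> orthogonal (P - B) (C - A) \<and> orthogonal (P - C) (A - B))"

definition centroid :: "real^2 \<Rightarrow> real^2 \<Rightarrow> real^2 \<Rightarrow> real^2" where
  "centroid A B C = (1/3) *\<^sub>R (A + B + C)"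

definition de_longchamps_point :: "real^2 \<Rightarrow> real^2 \<Rightarrow> real^2 \<Rightarrow> real^2" where
  "de_longchamps_point A B C = 2 *\<^sub>R circumcenter A B C - orthocenter A B C"

(* For a non-equilateral triangle the two points are distinct and this is a line; for an
   equilateral triangle, which has no Euler line, it is just the center. *)
definition euler_line :: "real^2 \<Rightarrow> real^2 \<Rightarrow> real^2 \<Rightarrow> (real^2) set" where
  "euler_line A B C = line (circumcenter A B C) (orthocenter A B C)"

definition equidistant_from_sides :: "real^2 \<Rightarrow> real^2 \<Rightarrow> real^2 \<Rightarrow> real^2 \<Rightarrow> bool" where
  "equidistant_from_sides A B C P \<longleftrightarrow>
     infdist P (line B C) = infdist P (line C A) \<and> infdist P (line C A) = infdist P (line A B)"

definition incenter :: "real^2 \<Rightarrow> real^2 \<Rightarrow> real^2 \<Rightarrow> real^2" where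
  "incenter A B C =
     (THE P. P \<in> interior (convex hull {A, B, C}) \<and> equidistant_from_sides A B C P)"

(* The excenter opposite A. Among the four points equidistant from the side lines it is the
   only one that is joined to A by a segment crossing the side BC. *)
definition excenter :: "real^2 \<Rightarrow> real^2 \<Rightarrow> real^2 \<Rightarrow> real^2" where
  "excenter A B C =
     (THE P. equidistant_from_sides A B C P \<and> open_segment A P \<inter> open_segment B C \<noteq> {})"

(* The arc BC of the circumcircle not containing A, without its endpoints: a point P of the
   circle lies on it iff the chords AP and BC cross. *)
definition opposite_arc :: "real^2 \<Rightarrow> real^2 \<Rightarrow> real^2 \<Rightarrow> (real^2) set" where
  "opposite_arc A B C =
     {P. dist (circumcenter A B C) P = dist (circumcenter A B C) A \<and>
         open_segment A P \<inter> open_segment B C \<noteq> {}}"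

definition mid_arc :: "real^2 \<Rightarrow> real^2 \<Rightarrow> real^2 \<Rightarrow> real^2" where
  "mid_arc A B C = (THE P. P \<in> opposite_arc A B C \<and> dist P B = dist P C)"

(* Reflection in the internal bisector of the angle AVB; sgn normalizes a vector, so w is a
   direction vector of that bisector. *)
definition bisector_reflection :: "real^2 \<Rightarrow> real^2 \<Rightarrow> real^2 \<Rightarrow> real^2 \<Rightarrow> real^2" where
  "bisector_reflection V A B X =
     (let w = sgn (A - V) + sgn (B - V)
      in V + (2 * ((X - V) \<bullet> w) / (w \<bullet> w)) *\<^sub>R w - (X - V))"

definition isogonal_conjugate :: "real^2 \<Rightarrow> real^2 \<Rightarrow> real^2 \<Rightarrow> real^2 \<Rightarrow> real^2" where
  "isogonal_conjugate A B C P =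
     (THE Q. Q \<in> bisector_reflection A B C ` line A P \<and>
             Q \<in> bisector_reflection B C A ` line B P \<and>
             Q \<in> bisector_reflection C A B ` line C P)"

definition lemoine_point :: "real^2 \<Rightarrow> real^2 \<Rightarrow> real^2 \<Rightarrow> real^2" where
  "lemoine_point A B C = isogonal_conjugate A B C (centroid A B C)"

definition mittenpunkt :: "real^2 \<Rightarrow> real^2 \<Rightarrow> real^2 \<Rightarrow> real^2" where
  "mittenpunkt A B C = lemoine_point (excenter A B C) (excenter B C A) (excenter C A B)"

definition bevan_point :: "real^2 \<Rightarrow> real^2 \<Rightarrow> real^2 \<Rightarrow> real^2" where
  "bevan_point A B C = circumcenter (excenter A B C) (excenter B C A) (excenter C A B)"

definition schiffler_point :: "real^2 \<Rightarrow> real^2 \<Rightarrow> real^2 \<Rightarrow> real^2" where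
  "schiffler_point A B C =
     (let I = incenter A B C
      in THE S. S \<in> euler_line A B C \<and> S \<in> euler_line I B C \<and>
                S \<in> euler_line I C A \<and> S \<in> euler_line I A B)"

(* Z is the center, u and v are orthonormal directions of the transverse and conjugate axes,
   a and b are the semi-axes; the asymptotes are the lines through Z with directions
   a u + b v and a u - b v. *)
definition has_hyperbola_equation ::
  "(real^2) set \<Rightarrow> real^2 \<Rightarrow> real^2 \<Rightarrow> real^2 \<Rightarrow> real \<Rightarrow> real \<Rightarrow> bool" where
  "has_hyperbola_equation \<H> Z u v a b \<longleftrightarrow>
     norm u = 1 \<and> norm v = 1 \<and> orthogonal u v \<and> a > 0 \<and> b > 0 \<and>
     \<H> = {P. ((P - Z) \<bullet> u)\<^sup>2 / a\<^sup>2 - ((P - Z) \<bullet> v)\<^sup>2 / b\<^sup>2 = 1}"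

definition is_hyperbola :: "(real^2) set \<Rightarrow> bool" where
  "is_hyperbola \<H> \<longleftrightarrow> (\<exists>Z u v a b. has_hyperbola_equation \<H> Z u v a b)"

definition is_rectangular_hyperbola :: "(real^2) set \<Rightarrow> bool" where
  "is_rectangular_hyperbola \<H> \<longleftrightarrow>
     (\<exists>Z u v a b. has_hyperbola_equation \<H> Z u v a b \<and>
        orthogonal (a *\<^sub>R u + b *\<^sub>R v) (a *\<^sub>R u - b *\<^sub>R v))"

definition is_jerabek_hyperbola :: "(real^2) set \<Rightarrow> real^2 \<Rightarrow> real^2 \<Rightarrow> real^2 \<Rightarrow> bool" where
  "is_jerabek_hyperbola \<H> A B C \<longleftrightarrow>
     is_hyperbola \<H> \<and> {A, B, C} \<subseteq> \<H> \<and>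
     circumcenter A B C \<in> \<H> \<and> orthocenter A B C \<in> \<H> \<and> lemoine_point A B C \<in> \<H> \<and>
     isogonal_conjugate A B C (de_longchamps_point A B C) \<in> \<H>"

end

theory Submission
  imports Defs
begin

text \<open>
  Let \<open>D\<close>, \<open>E\<close>, \<open>F\<close> be the arc midpoints, \<open>I\<close> the incenter and \<open>O\<close> the circumcenter of \<open>ABC\<close>.
  The homothety with center \<open>I\<close> and ratio \<open>2\<close> maps \<open>DEF\<close> to the excentral triangle, and
  \<open>I\<close> and \<open>O\<close> are the orthocenter and the circumcenter of \<open>DEF\<close>. Hence the midpoint of
  mittenpunkt and incenter is the Lemoine point of \<open>DEF\<close>, and the Bevan point \<open>2O - I\<close> is the
  de Longchamps point of \<open>DEF\<close>, so that four of the five points lie on the conic by its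
  definition. A hyperbola through the vertices and the orthocenter of a non-right triangle is
  rectangular.

  For the Schiffler point let \<open>x\<close>, \<open>y\<close>, \<open>z\<close> be the lengths of the tangents from \<open>A\<close>, \<open>B\<close>, \<open>C\<close> to
  the incircle, so that the sides are \<open>y + z\<close>, \<open>z + x\<close>, \<open>x + y\<close>. With respect to \<open>DEF\<close>, the
  barycentric coordinates of \<open>I\<close>, \<open>O\<close> and the Schiffler point are proportional to \<open>x\<close>, to \<open>y + z\<close> and to
  \<open>x (y + z) / (2 x + y + z)\<close>, cyclically. A circumconic of \<open>DEF\<close> imposes a linear condition on
  the reciprocals of the coordinates, and
  \<open>(2 x + y + z) / (x (y + z)) = 2 / (y + z) + 1 / x\<close>, so a circumconic through \<open>I\<close> and \<open>O\<close>
  passes through the Schiffler point.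
\<close>

section \<open>Plane vectors and affine coordinates\<close>

definition cross :: "real^2 \<Rightarrow> real^2 \<Rightarrow> real" where
  "cross u v = u $ 1 * v $ 2 - u $ 2 * v $ 1"

lemma inner_real2: "u \<bullet> v = u $ 1 * v $ 1 + u $ 2 * v $ 2" for u v :: "real^2"
  by (simp add: inner_vec_def sum_2)

lemma cross_combination:
  "cross (p *\<^sub>R u + q *\<^sub>R v) (p' *\<^sub>R u + q' *\<^sub>R v) = (p * q' - q * p') * cross u v"
  by (simp add: cross_def algebra_simps)

lemma cross_scaleR_self [simp]: "cross u (c *\<^sub>R u) = 0" "cross u 0 = 0" "cross 0 u = 0"
  by (simp_all add: cross_def)

text \<open>Lagrange's identity in the plane. It trades areas for inner products, and nonnegativity
  of the square is the Cauchy-Schwarz inequality.\<close>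

lemma cross_squared: "(cross u v)\<^sup>2 = (u \<bullet> u) * (v \<bullet> v) - (u \<bullet> v)\<^sup>2"
  by (simp add: cross_def inner_real2 power2_eq_square algebra_simps)

lemma cross_eq_0_parallel:
  assumes "cross u v = 0" "u \<noteq> 0"
  shows "\<exists>c. v = c *\<^sub>R u"
proof -
  have "u \<bullet> u \<noteq> 0" using assms(2) by simp
  have "v = ((u \<bullet> v) / (u \<bullet> u)) *\<^sub>R u"
  proof -
    have "u $ 1 * v $ 2 = u $ 2 * v $ 1"
      using assms(1) by (simp add: cross_def)
    then have "(u \<bullet> u) *\<^sub>R v = (u \<bullet> v) *\<^sub>R u"
      by (simp add: vec_eq_iff forall_2 inner_real2) algebra
    then have "(1 / (u \<bullet> u)) *\<^sub>R (u \<bullet> u) *\<^sub>R v = (1 / (u \<bullet> u)) *\<^sub>R (u \<bullet> v) *\<^sub>R u"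
      by simp
    then show ?thesis using \<open>u \<bullet> u \<noteq> 0\<close> by simp
  qed
  then show ?thesis by blast
qed

lemma collinear_iff_cross: "collinear {P, Q, R} \<longleftrightarrow> cross (Q - P) (R - P) = 0"
  for P Q R :: "real^2"
proof -
  have "collinear {P, Q, R} \<longleftrightarrow> collinear {Q, P, R}"
    by (simp add: insert_commute)
  also have "\<dots> \<longleftrightarrow> collinear {0, Q - P, R - P}"
    by (cases "P = 0") (use collinear_3[of Q P R] in \<open>auto simp: insert_commute\<close>)
  also have "\<dots> \<longleftrightarrow> cross (Q - P) (R - P) = 0"
  proof (cases "Q - P = 0")
    case False
    then show ?thesis
      using cross_eq_0_parallel[of "Q - P" "R - P"]
      unfolding collinear_lemma by auto
  qed simp
  finally show ?thesis .
qed

text \<open>Cramer's rule recovers both components of \<open>w\<close>. This serves uniqueness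
  proofs, where the difference of two candidate centers is orthogonal to two sides.\<close>

lemma orthogonal_to_basis_eq_0:
  assumes "cross u v \<noteq> 0" "w \<bullet> u = 0" "w \<bullet> v = 0"
  shows "w = 0"
proof -
  have "w $ 1 * cross u v = (w \<bullet> u) * v $ 2 - (w \<bullet> v) * u $ 2"
    "w $ 2 * cross u v = (w \<bullet> v) * u $ 1 - (w \<bullet> u) * v $ 1"
    by (simp_all add: cross_def inner_real2 algebra_simps)
  then show ?thesis
    using assms by (simp add: vec_eq_iff forall_2)
qed

lemma affine_coordinates:
  assumes "\<not> collinear {A, B, C :: real^2}"
  obtains p q r where "p + q + r = 1" "P = p *\<^sub>R A + q *\<^sub>R B + r *\<^sub>R C"
proof -
  define d where "d = cross (B - A) (C - A)"
  have d: "d \<noteq> 0"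
    using assms by (simp add: d_def collinear_iff_cross)
  \<comment> \<open>Barycentric coordinates as quotients of signed areas.\<close>
  define q r where "q = cross (P - A) (C - A) / d" and "r = cross (B - A) (P - A) / d"
  have "d *\<^sub>R (P - A) = (d * q) *\<^sub>R (B - A) + (d * r) *\<^sub>R (C - A)"
    using d by (simp add: q_def r_def) (simp add: d_def cross_def vec_eq_iff forall_2 algebra_simps)
  then have "d *\<^sub>R (P - A) = d *\<^sub>R (q *\<^sub>R (B - A) + r *\<^sub>R (C - A))"
    by (simp add: scaleR_add_right)
  then have "P - A = q *\<^sub>R (B - A) + r *\<^sub>R (C - A)"
    using d by simp
  then have "P = (1 - q - r) *\<^sub>R A + q *\<^sub>R B + r *\<^sub>R C"
    by (simp add: algebra_simps eq_diff_eq)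
  then show thesis
    using that[of "1 - q - r" q r] by simp
qed

text \<open>The difference of the two representations is a vanishing combination of
  \<open>B - A\<close> and \<open>C - A\<close>; its cross product with either vector isolates one
  coefficient.\<close>

lemma affine_coordinates_unique:
  assumes "\<not> collinear {A, B, C :: real^2}"
    and "p *\<^sub>R A + q *\<^sub>R B + r *\<^sub>R C = p' *\<^sub>R A + q' *\<^sub>R B + r' *\<^sub>R C"
    and "p + q + r = p' + q' + r'"
  shows "p = p'" "q = q'" "r = r'"
proof -
  have d: "cross (B - A) (C - A) \<noteq> 0"
    using assms(1) by (simp add: collinear_iff_cross)
  have p: "p - p' = (q' - q) + (r' - r)"
    using assms(3) by simp
  have "0 = (p - p') *\<^sub>R A + (q - q') *\<^sub>R B + (r - r') *\<^sub>R C"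
    using assms(2) by (simp add: algebra_simps)
  also have "\<dots> = (q - q') *\<^sub>R (B - A) + (r - r') *\<^sub>R (C - A)"
    unfolding p by (simp add: algebra_simps)
  finally have 0: "(q - q') *\<^sub>R (B - A) + (r - r') *\<^sub>R (C - A) = 0" by simp
  show "q = q'"
    using d cross_combination[of "q - q'" "B - A" "r - r'" "C - A" 0 1] 0 by (simp add: cross_def)
  moreover show "r = r'"
    using d cross_combination[of "q - q'" "B - A" "r - r'" "C - A" 1 0] 0 by (simp add: cross_def)
  ultimately show "p = p'"
    using assms(3) by simp
qed

lemma cross_affine_coordinates:
  assumes "p + q + r = 1"
  shows "cross (B - (p *\<^sub>R A + q *\<^sub>R B + r *\<^sub>R C)) (C - (p *\<^sub>R A + q *\<^sub>R B + r *\<^sub>R C))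
    = p * cross (B - A) (C - A)"
proof -
  have p: "p = 1 - q - r" using assms by simp
  show ?thesis
    unfolding p cross_def by (simp add: algebra_simps)
qed

text \<open>Area of a parallelogram divided by its base: the foot of the perpendicular attains the
  value, and Cauchy-Schwarz bounds the distance to every point of the line from below.\<close>

lemma infdist_line:
  assumes "B \<noteq> C"
  shows "infdist P (line B C) = \<bar>cross (B - P) (C - P)\<bar> / dist B C"
proof (rule antisym)
  define e where "e = C - B"
  have e: "e \<bullet> e > 0" using assms by (simp add: e_def)
  have dist: "dist B C = sqrt (e \<bullet> e)"
    by (simp add: e_def dist_norm norm_eq_sqrt_inner[symmetric] norm_minus_commute)
  have on_line: "X \<in> line B C \<longleftrightarrow> (\<exists>t. X = B + t *\<^sub>R e)" for X
    by (auto simp: affine_hull_2_alt e_def)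
  define t where "t = ((P - B) \<bullet> e) / (e \<bullet> e)"
  define w where "w = P - (B + t *\<^sub>R e)"
  have "w \<bullet> e = 0"
    using e by (simp add: w_def t_def inner_diff_left inner_add_left)
  then have w: "norm w * sqrt (e \<bullet> e) = \<bar>cross w e\<bar>"
    using cross_squared[of w e]
    by (metis diff_zero norm_eq_sqrt_inner power_zero_numeral real_sqrt_abs real_sqrt_mult)
  have cross: "cross (P - (B + t *\<^sub>R e)) e = - cross (B - P) (C - P)" for t
    by (simp add: cross_def e_def algebra_simps)
  have "infdist P (line B C) \<le> norm w"
    using infdist_le[of "B + t *\<^sub>R e" "line B C" P] by (auto simp: on_line w_def dist_norm)
  also have "\<dots> = \<bar>cross (B - P) (C - P)\<bar> / dist B C"
    using w e unfolding dist w_def cross by (simp add: field_simps)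
  finally show "infdist P (line B C) \<le> \<bar>cross (B - P) (C - P)\<bar> / dist B C" .
  have "\<bar>cross (B - P) (C - P)\<bar> / dist B C \<le> dist P X" if X: "X \<in> line B C" for X
  proof -
    obtain t where t: "X = B + t *\<^sub>R e" using X on_line by blast
    have "(cross (P - X) e)\<^sup>2 \<le> ((P - X) \<bullet> (P - X)) * (e \<bullet> e)"
      unfolding cross_squared by simp
    then have "\<bar>cross (P - X) e\<bar> \<le> norm (P - X) * sqrt (e \<bullet> e)"
      by (metis norm_eq_sqrt_inner real_sqrt_abs real_sqrt_le_iff real_sqrt_mult)
    then show ?thesis
      using e unfolding t cross dist by (simp add: dist_norm field_simps)
  qed
  then show "\<bar>cross (B - P) (C - P)\<bar> / dist B C \<le> infdist P (line B C)"
    unfolding infdist_def by (auto intro!: cINF_greatest)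
qed

text \<open>From \<open>A\<close> to \<open>P\<close> the first coordinate runs from 1 to
  \<open>p\<close>, while the other two grow from 0 in proportion to \<open>q\<close> and
  \<open>r\<close>. This sign pattern later singles out excenters and arc midpoints.\<close>

lemma segments_cross_iff:
  assumes nc: "\<not> collinear {A, B, C :: real^2}"
    and sum: "p + q + r = 1" and P: "P = p *\<^sub>R A + q *\<^sub>R B + r *\<^sub>R C"
  shows "open_segment A P \<inter> open_segment B C \<noteq> {} \<longleftrightarrow> p < 0 \<and> 0 < q \<and> 0 < r"
proof
  assume "open_segment A P \<inter> open_segment B C \<noteq> {}"
  then obtain t s where t: "0 < t" "t < 1" and s: "0 < s" "s < 1"
    and eq: "(1 - t) *\<^sub>R A + t *\<^sub>R P = (1 - s) *\<^sub>R B + s *\<^sub>R C"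
    by (auto simp: in_segment)
  have "(1 - t + t * p) *\<^sub>R A + (t * q) *\<^sub>R B + (t * r) *\<^sub>R C
      = 0 *\<^sub>R A + (1 - s) *\<^sub>R B + s *\<^sub>R C"
    using eq unfolding P by (simp add: algebra_simps)
  moreover have "1 - t + t * p + t * q + t * r = 0 + (1 - s) + s"
    using arg_cong[OF sum, of "(*) t"] by (simp add: algebra_simps)
  ultimately have "1 - t + t * p = 0" "t * q = 1 - s" "t * r = s"
    using affine_coordinates_unique[OF nc] by blast+
  then have "t * p < 0" "t * q > 0" "t * r > 0" using t s by auto
  then show "p < 0 \<and> 0 < q \<and> 0 < r"
    using t by (auto simp: zero_less_mult_iff mult_less_0_iff)
next
  assume pqr: "p < 0 \<and> 0 < q \<and> 0 < r"
  \<comment> \<open>The parameter at which the first coordinate \<open>1 - t + t * p\<close>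
    vanishes.\<close>
  define t where "t = 1 / (1 - p)"
  have t: "0 < t" "t < 1" using pqr by (auto simp: t_def)
  have p: "t * p = t - 1" using pqr by (simp add: t_def field_simps)
  have s: "t * q = 1 - t * r"
    using arg_cong[OF sum, of "(*) t"] p by (simp add: algebra_simps)
  have "A \<noteq> P"
    using affine_coordinates_unique(1)[OF nc, of p q r 1 0 0] P sum pqr by auto
  moreover have "B \<noteq> C" using nc by (auto simp: insert_commute)
  moreover have "(1 - t) *\<^sub>R A + t *\<^sub>R P = (1 - t * r) *\<^sub>R B + (t * r) *\<^sub>R C"
  proof -
    have "(1 - t) *\<^sub>R A + t *\<^sub>R P = (1 - t + t * p) *\<^sub>R A + (t * q) *\<^sub>R B + (t * r) *\<^sub>R C"
      unfolding P by (simp add: algebra_simps)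
    then show ?thesis by (simp add: p s)
  qed
  moreover have "0 < t * r" "t * r < 1"
    using t pqr s by (auto, smt (verit) mult_pos_pos)
  ultimately have "(1 - t) *\<^sub>R A + t *\<^sub>R P \<in> open_segment A P \<inter> open_segment B C"
    using t by (auto simp: in_segment)
  then show "open_segment A P \<inter> open_segment B C \<noteq> {}" by blast
qed

text \<open>A form of Stewart's theorem, obtained by expanding inner products. It turns distances
  into algebra in coordinates and side lengths.\<close>

lemma dist_affine_combination:
  fixes P Q R X :: "'a::real_inner"
  assumes "p + q + r = 1"
  shows "(dist (p *\<^sub>R P + q *\<^sub>R Q + r *\<^sub>R R) X)\<^sup>2
    = p * (dist P X)\<^sup>2 + q * (dist Q X)\<^sup>2 + r * (dist R X)\<^sup>2
      - (q * r * (dist Q R)\<^sup>2 + r * p * (dist R P)\<^sup>2 + p * q * (dist P Q)\<^sup>2)"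
proof -
  have p: "p = 1 - q - r" using assms by simp
  show ?thesis
    unfolding p dist_norm power2_norm_eq_inner
    by (simp add: inner_add_left inner_add_right inner_diff_left inner_diff_right
        inner_commute algebra_simps)
qed

section \<open>Circumcenter and orthocenter in vector form\<close>

lemma circumcenter_unique:
  assumes "\<not> collinear {A, B, C}" "dist P A = dist P B" "dist P A = dist P C"
  shows "circumcenter A B C = P"
  unfolding circumcenter_def
proof (rule the_equality)
  fix X assume X: "dist X A = dist X B \<and> dist X A = dist X C"
  have "(X - P) \<bullet> (U - A) = 0" if "dist X A = dist X U" "dist P A = dist P U" for U
    using that unfolding dist_norm norm_eq
    by (simp add: inner_add_left inner_add_right inner_diff_left inner_diff_right inner_commute)
  then have "X - P = 0"
    using X assms by (intro orthogonal_to_basis_eq_0[of "B - A" "C - A"]) (auto simp: collinear_iff_cross)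
  then show "X = P" by simp
qed (use assms in auto)

lemma circumcenter_exists:
  assumes "\<not> collinear {A, B, C :: real^2}"
  obtains P where "dist P A = dist P B" "dist P A = dist P C"
proof -
  define u v where "u = B - A" and "v = C - A"
  define d where "d = cross u v"
  have d: "d \<noteq> 0" using assms by (simp add: d_def u_def v_def collinear_iff_cross)
  \<comment> \<open>Cramer's solution of \<open>2 * (w \<bullet> u) = u \<bullet> u\<close> and
    \<open>2 * (w \<bullet> v) = v \<bullet> v\<close>, the perpendicular bisectors relative to
    \<open>A\<close>.\<close>
  define w :: "real^2" where
    "w = vector [(u \<bullet> u * v $ 2 - v \<bullet> v * u $ 2) / (2 * d), (v \<bullet> v * u $ 1 - u \<bullet> u * v $ 1) / (2 * d)]"
  have "2 * d * (w \<bullet> u) = d * (u \<bullet> u)" "2 * d * (w \<bullet> v) = d * (v \<bullet> v)"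
    using d by (simp_all add: w_def inner_real2[of _ u] inner_real2[of _ v] field_simps)
      (simp_all add: d_def cross_def inner_real2 algebra_simps)
  then have "2 * (w \<bullet> u) = u \<bullet> u" "2 * (w \<bullet> v) = v \<bullet> v"
    using d by simp_all
  then have "dist (A + w) A = dist (A + w) B" "dist (A + w) A = dist (A + w) C"
    unfolding dist_norm norm_eq u_def v_def
    by (simp_all add: inner_add_left inner_add_right inner_diff_left inner_diff_right inner_commute)
  then show thesis using that by blast
qed

lemma dist_circumcenter:
  assumes "\<not> collinear {A, B, C}"
  shows "dist (circumcenter A B C) B = dist (circumcenter A B C) A"
    and "dist (circumcenter A B C) C = dist (circumcenter A B C) A"
proof -
  obtain P where P: "dist P A = dist P B" "dist P A = dist P C"
    using circumcenter_exists[OF assms] .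
  then show "dist (circumcenter A B C) B = dist (circumcenter A B C) A"
    "dist (circumcenter A B C) C = dist (circumcenter A B C) A"
    using circumcenter_unique[OF assms P] by simp_all
qed

text \<open>\<open>X\<close> lies on the perpendicular bisector of \<open>Q\<close> and
  \<open>R\<close>, and the first factor is twice the vector from \<open>X\<close> to their
  midpoint.\<close>

lemma inner_sum_diff_eq_0:
  fixes X Q R :: "'a::real_inner"
  assumes "dist X Q = dist X R"
  shows "(Q + R - 2 *\<^sub>R X) \<bullet> (Q - R) = 0"
  using assms unfolding dist_norm norm_eq
  by (simp add: inner_add_left inner_add_right inner_diff_left inner_diff_right inner_commute
      algebra_simps)

text \<open>Sylvester's relation: for this point the vector from \<open>A\<close> is twice the
  vector from the circumcenter to the midpoint of \<open>B\<close> and \<open>C\<close>, hence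
  perpendicular to that side.\<close>

lemma orthocenter_eq:
  assumes nc: "\<not> collinear {A, B, C}"
  shows "orthocenter A B C = A + B + C - 2 *\<^sub>R circumcenter A B C"
  unfolding orthocenter_def
proof (rule the_equality)
  define X where "X = circumcenter A B C"
  have X: "dist X A = dist X B" "dist X B = dist X C" "dist X C = dist X A"
    using dist_circumcenter[OF nc] by (simp_all add: X_def)
  have H: "orthogonal (A + B + C - 2 *\<^sub>R X - A) (B - C)" "orthogonal (A + B + C - 2 *\<^sub>R X - B) (C - A)"
    "orthogonal (A + B + C - 2 *\<^sub>R X - C) (A - B)"
    using X[THEN inner_sum_diff_eq_0] by (simp_all add: orthogonal_def algebra_simps)
  then show "orthogonal (A + B + C - 2 *\<^sub>R circumcenter A B C - A) (B - C) \<and>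
    orthogonal (A + B + C - 2 *\<^sub>R circumcenter A B C - B) (C - A) \<and>
    orthogonal (A + B + C - 2 *\<^sub>R circumcenter A B C - C) (A - B)"
    by (simp add: X_def)
  fix P assume P: "orthogonal (P - A) (B - C) \<and> orthogonal (P - B) (C - A) \<and> orthogonal (P - C) (A - B)"
  have "P - (A + B + C - 2 *\<^sub>R X) = 0"
  proof (rule orthogonal_to_basis_eq_0[of "B - A" "C - A"])
    show "(P - (A + B + C - 2 *\<^sub>R X)) \<bullet> (B - A) = 0" "(P - (A + B + C - 2 *\<^sub>R X)) \<bullet> (C - A) = 0"
      using P H by (auto simp: orthogonal_def inner_diff_left inner_add_left inner_diff_right)
  qed (use nc in \<open>simp add: collinear_iff_cross\<close>)
  then show "P = A + B + C - 2 *\<^sub>R circumcenter A B C" by (simp add: X_def)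
qed

lemma add_scaleR_combinations:
  "a *\<^sub>R (p *\<^sub>R A + q *\<^sub>R B + r *\<^sub>R C) + b *\<^sub>R (p' *\<^sub>R A + q' *\<^sub>R B + r' *\<^sub>R C)
     + c *\<^sub>R (p'' *\<^sub>R A + q'' *\<^sub>R B + r'' *\<^sub>R C)
   = (a * p + b * p' + c * p'') *\<^sub>R A + (a * q + b * q' + c * q'') *\<^sub>R B
     + (a * r + b * r' + c * r'') *\<^sub>R (C :: 'a::real_vector)"
  by (simp add: algebra_simps)

lemma combination_cong:
  "p = p' \<Longrightarrow> q = q' \<Longrightarrow> r = r' \<Longrightarrow>
    p *\<^sub>R A + q *\<^sub>R B + r *\<^sub>R C = p' *\<^sub>R A + q' *\<^sub>R B + r' *\<^sub>R (C :: 'a::real_vector)"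
  by simp

text \<open>\<open>r \<noteq> 0\<close> keeps \<open>X\<close> off the line \<open>A B\<close>, so
  the two lines are distinct; comparing the coordinates of \<open>Y\<close> on both forces the
  parameter 1.\<close>

lemma lines_from_vertices_meet:
  assumes nc: "\<not> collinear {A, B, C :: real^2}" and sum: "p + q + r = 1" and "r \<noteq> 0"
    and X: "X = p *\<^sub>R A + q *\<^sub>R B + r *\<^sub>R C"
    and Y: "Y \<in> line A X" "Y \<in> line B X"
  shows "Y = X"
proof -
  obtain s t where s: "Y = A + s *\<^sub>R (X - A)" and t: "Y = B + t *\<^sub>R (X - B)"
    using Y unfolding affine_hull_2_alt by blast
  have eq: "(1 - s + s * p) *\<^sub>R A + (s * q) *\<^sub>R B + (s * r) *\<^sub>R C
      = (t * p) *\<^sub>R A + (1 - t + t * q) *\<^sub>R B + (t * r) *\<^sub>R C"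
    using s t unfolding X by (simp add: algebra_simps)
  have "s * (p + q + r) = s" "t * (p + q + r) = t" using sum by simp_all
  then have "1 - s + s * p + s * q + s * r = t * p + (1 - t + t * q) + t * r"
    by (simp add: algebra_simps)
  then have "s * r = t * r" "1 - s + s * p = t * p"
    using affine_coordinates_unique[OF nc eq] by blast+
  then have "s = 1" using \<open>r \<noteq> 0\<close> by simp
  then show ?thesis using s by simp
qed

section \<open>Symmedians\<close>

text \<open>The diagonal \<open>e + f\<close> of a rhombus bisects its angle; algebraically,
  \<open>2 * (e \<bullet> (e + f))\<close> is the squared length of \<open>e + f\<close>.\<close>

lemma reflection_swaps_unit_vectors:
  fixes e f :: "'a::real_inner"
  assumes "norm e = 1" "norm f = 1" "e + f \<noteq> 0"
  shows "(2 * (e \<bullet> (e + f)) / ((e + f) \<bullet> (e + f))) *\<^sub>R (e + f) - e = f"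
proof -
  have "2 * (e \<bullet> (e + f)) = (e + f) \<bullet> (e + f)"
    using assms(1,2) by (simp add: norm_eq_1 inner_add_left inner_add_right inner_commute)
  then show ?thesis using assms(3) by simp
qed

text \<open>With unit vectors \<open>e\<close>, \<open>f\<close> along the sides, the median has
  direction \<open>b *\<^sub>R e + c *\<^sub>R f\<close>. The reflection swaps \<open>e\<close> and
  \<open>f\<close>, which gives the symmedian.\<close>

lemma bisector_reflection_median:
  assumes nc: "\<not> collinear {V, A, B}"
  defines "b \<equiv> dist A V" and "c \<equiv> dist B V"
  shows "bisector_reflection V A B (V + t *\<^sub>R ((A - V) + (B - V)))
    = V + (t / (b * c)) *\<^sub>R (c\<^sup>2 *\<^sub>R (A - V) + b\<^sup>2 *\<^sub>R (B - V))"
proof -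
  define e f where "e = sgn (A - V)" and "f = sgn (B - V)"
  have ne: "A \<noteq> V" "B \<noteq> V" using nc by (auto simp: insert_commute)
  then have bc: "b > 0" "c > 0" by (simp_all add: b_def c_def)
  have unit: "norm e = 1" "norm f = 1" using ne by (simp_all add: e_def f_def norm_sgn)
  have AB: "A - V = b *\<^sub>R e" "B - V = c *\<^sub>R f"
    using ne by (simp_all add: e_def f_def b_def c_def dist_norm sgn_div_norm)
  have ef: "e + f \<noteq> 0"
  proof
    assume "e + f = 0"
    then have "B - V = - (c *\<^sub>R e)" using AB by (simp add: eq_neg_iff_add_eq_0 add.commute flip: scaleR_add_right)
    then show False
      using nc AB(1) by (simp add: collinear_iff_cross cross_def)
  qed
  define k where "k = (\<lambda>X. 2 * (X \<bullet> (e + f)) / ((e + f) \<bullet> (e + f)))"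
  have e: "k e *\<^sub>R (e + f) - e = f"
    using reflection_swaps_unit_vectors[OF unit ef] by (simp add: k_def)
  have f: "k f *\<^sub>R (e + f) - f = e"
    using reflection_swaps_unit_vectors[OF unit(2,1)] ef by (simp add: k_def add.commute)
  have k: "k (t *\<^sub>R (b *\<^sub>R e + c *\<^sub>R f)) = t * b * k e + t * c * k f"
    by (simp add: k_def inner_add_left add_divide_distrib algebra_simps)
  have "bisector_reflection V A B (V + t *\<^sub>R ((A - V) + (B - V)))
      = V + (k (t *\<^sub>R (b *\<^sub>R e + c *\<^sub>R f)) *\<^sub>R (e + f) - t *\<^sub>R (b *\<^sub>R e + c *\<^sub>R f))"
    unfolding bisector_reflection_def Let_def e_def[symmetric] f_def[symmetric]
    by (simp add: k_def AB(1)[symmetric] AB(2)[symmetric])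
  also have "\<dots> = V + ((t * b) *\<^sub>R (k e *\<^sub>R (e + f) - e) + (t * c) *\<^sub>R (k f *\<^sub>R (e + f) - f))"
    unfolding k by (simp add: algebra_simps)
  also have "\<dots> = V + ((t * b) *\<^sub>R f + (t * c) *\<^sub>R e)" by (simp only: e f)
  also have "\<dots> = V + (t / (b * c)) *\<^sub>R (c\<^sup>2 *\<^sub>R (A - V) + b\<^sup>2 *\<^sub>R (B - V))"
    unfolding AB using bc by (simp add: power2_eq_square algebra_simps)
  finally show ?thesis .
qed

text \<open>Only a nonzero multiple of \<open>K - V\<close> is prescribed, so that all three
  vertices of a triangle can share one \<open>K\<close> and one factor \<open>k\<close>.\<close>

lemma bisector_reflection_median_line:
  assumes nc: "\<not> collinear {V, A, B}"
    and K: "k *\<^sub>R (K - V) = (dist B V)\<^sup>2 *\<^sub>R (A - V) + (dist A V)\<^sup>2 *\<^sub>R (B - V)" and "k \<noteq> 0"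
  shows "bisector_reflection V A B ` line V (centroid V A B) = line V K"
proof -
  define m where "m = dist A V * dist B V"
  have m: "m \<noteq> 0" using nc by (auto simp: m_def insert_commute)
  have median: "line V (centroid V A B) = range (\<lambda>t. V + t *\<^sub>R ((A - V) + (B - V)))"
  proof -
    have centroid: "centroid V A B - V = (1 / 3) *\<^sub>R ((A - V) + (B - V))"
      by (simp add: centroid_def vec_eq_iff algebra_simps)
    have "range (\<lambda>t. V + (t / 3) *\<^sub>R ((A - V) + (B - V))) = range (\<lambda>t. V + t *\<^sub>R ((A - V) + (B - V)))"
      (is "range (\<lambda>t. ?h (t / 3)) = range ?h")
    proof -
      have "?h t = ?h ((3 * t) / 3)" for t by simp
      then show ?thesis by blast
    qed
    then show ?thesis by (simp add: affine_hull_2_alt centroid)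
  qed
  have "bisector_reflection V A B ` line V (centroid V A B) = range (\<lambda>t. V + (t * k / m) *\<^sub>R (K - V))"
    unfolding median image_image bisector_reflection_median[OF nc] K[symmetric] m_def by simp
  also have "\<dots> = range (\<lambda>t. V + t *\<^sub>R (K - V))" (is "range (\<lambda>t. ?h (t * k / m)) = range ?h")
  proof -
    have "?h t = ?h ((t * m / k) * k / m)" for t using m \<open>k \<noteq> 0\<close> by simp
    then show ?thesis by blast
  qed
  finally show ?thesis by (simp add: affine_hull_2_alt)
qed

text \<open>The reflected medians at the three vertices all pass through this point, and two of them
  meet nowhere else, which settles the \<open>THE\<close> of the isogonal conjugate.\<close>

lemma lemoine_point_eq:
  fixes P Q R :: "real^2"
  assumes nc: "\<not> collinear {P, Q, R}"
  defines "p \<equiv> (dist Q R)\<^sup>2" and "q \<equiv> (dist R P)\<^sup>2" and "r \<equiv> (dist P Q)\<^sup>2"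
  shows "lemoine_point P Q R = (1 / (p + q + r)) *\<^sub>R (p *\<^sub>R P + q *\<^sub>R Q + r *\<^sub>R R)"
proof -
  define k where "k = p + q + r"
  define K where "K = (1 / k) *\<^sub>R (p *\<^sub>R P + q *\<^sub>R Q + r *\<^sub>R R)"
  have "p > 0" "q > 0" "r > 0" using nc by (auto simp: p_def q_def r_def insert_commute)
  then have k: "k \<noteq> 0" by (simp add: k_def)
  have kK: "k *\<^sub>R K = p *\<^sub>R P + q *\<^sub>R Q + r *\<^sub>R R" using k by (simp add: K_def)
  have nc': "\<not> collinear {Q, R, P}" "\<not> collinear {R, P, Q}" using nc by (simp_all add: insert_commute)
  have centroid: "centroid Q R P = centroid P Q R" "centroid R P Q = centroid P Q R"
    by (simp_all add: centroid_def add_ac)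
  have "bisector_reflection P Q R ` line P (centroid P Q R) = line P K"
    by (rule bisector_reflection_median_line[OF nc _ k])
      (simp add: kK scaleR_diff_right, simp add: k_def p_def q_def r_def dist_commute algebra_simps)
  moreover have "bisector_reflection Q R P ` line Q (centroid Q R P) = line Q K"
    by (rule bisector_reflection_median_line[OF nc'(1) _ k])
      (simp add: kK scaleR_diff_right, simp add: k_def p_def q_def r_def dist_commute algebra_simps)
  moreover have "bisector_reflection R P Q ` line R (centroid R P Q) = line R K"
    by (rule bisector_reflection_median_line[OF nc'(2) _ k])
      (simp add: kK scaleR_diff_right, simp add: k_def p_def q_def r_def dist_commute algebra_simps)
  moreover have "Y = K" if "Y \<in> line P K" "Y \<in> line Q K" for Y
  proof (rule lines_from_vertices_meet[OF nc _ _ _ that])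
    show "p / k + q / k + r / k = 1" using k by (simp add: k_def flip: add_divide_distrib)
    show "r / k \<noteq> 0" using k \<open>r > 0\<close> by simp
  qed (simp add: K_def scaleR_add_right)
  moreover have "K \<in> line V K" for V by (simp add: hull_inc)
  ultimately have "lemoine_point P Q R = K"
    unfolding lemoine_point_def isogonal_conjugate_def centroid by (intro the_equality) auto
  then show ?thesis by (simp add: K_def k_def)
qed

section \<open>Incenter, excenters and arc midpoints\<close>

text \<open>Tangent lengths turn the triangle inequalities into positivity and make the coordinates
  of all centers below rational functions. Cyclic rotation preserves the locale, so a formula for
  one vertex yields the other two.\<close>

locale triangle =
  fixes A B C :: "real^2" and x y z :: real
  assumes noncollinear: "\<not> collinear {A, B, C}"
    and dist_BC: "dist B C = y + z"
    and dist_CA: "dist C A = z + x"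
    and dist_AB: "dist A B = x + y"
begin

lemma rotate: "triangle B C A y z x"
  using noncollinear dist_BC dist_CA dist_AB by unfold_locales (simp_all add: insert_commute)

text \<open>Heron's formula with semiperimeter \<open>x + y + z\<close>, from the law of cosines and
  Lagrange's identity.\<close>

lemma cross_sides_squared: "(cross (B - A) (C - A))\<^sup>2 = 4 * (x + y + z) * x * y * z"
proof -
  define u v where "u = B - A" and "v = C - A"
  have u: "u \<bullet> u = (x + y)\<^sup>2" and v: "v \<bullet> v = (z + x)\<^sup>2"
    and uv: "(u - v) \<bullet> (u - v) = (y + z)\<^sup>2"
    using dist_AB dist_CA dist_BC
    by (simp_all add: u_def v_def dist_norm norm_minus_commute flip: power2_norm_eq_inner)
  have "2 * (u \<bullet> v) = (x + y)\<^sup>2 + (z + x)\<^sup>2 - (y + z)\<^sup>2"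
    using uv unfolding u[symmetric] v[symmetric]
    by (simp add: inner_diff_left inner_diff_right inner_commute)
  moreover have "4 * (cross u v)\<^sup>2 = 4 * (x + y)\<^sup>2 * (z + x)\<^sup>2 - (2 * (u \<bullet> v))\<^sup>2"
    unfolding cross_squared u v by simp
  ultimately have "4 * (cross u v)\<^sup>2 = 4 * (4 * (x + y + z) * x * y * z)"
    by algebra
  then show ?thesis by (simp add: u_def v_def)
qed

text \<open>The triangle inequalities give nonnegativity; by Heron's formula a zero would make the
  area vanish.\<close>

lemma pos: "x > 0" "y > 0" "z > 0"
proof -
  have "x \<ge> 0" "y \<ge> 0" "z \<ge> 0"
    using dist_triangle[of B C A] dist_triangle[of C A B] dist_triangle[of A B C]
    by (simp_all add: dist_AB dist_BC dist_CA dist_commute[of B A] dist_commute[of C B] dist_commute[of A C])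
  moreover have "4 * (x + y + z) * x * y * z \<noteq> 0"
    unfolding cross_sides_squared[symmetric]
    using noncollinear by (simp add: collinear_iff_cross)
  ultimately show "x > 0" "y > 0" "z > 0" by auto
qed

lemma dist_to_combination:
  assumes "p + q + r = 1"
  shows "(dist (p *\<^sub>R A + q *\<^sub>R B + r *\<^sub>R C) X)\<^sup>2
    = p * (dist A X)\<^sup>2 + q * (dist B X)\<^sup>2 + r * (dist C X)\<^sup>2
      - (q * r * (y + z)\<^sup>2 + r * p * (z + x)\<^sup>2 + p * q * (x + y)\<^sup>2)"
  using dist_affine_combination[OF assms, of A B C X] by (simp only: dist_AB dist_BC dist_CA)

lemma infdist_side:
  assumes "p + q + r = 1" "P = p *\<^sub>R A + q *\<^sub>R B + r *\<^sub>R C"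
  shows "infdist P (line B C) = \<bar>p\<bar> / (y + z) * \<bar>cross (B - A) (C - A)\<bar>"
proof -
  have "B \<noteq> C" using noncollinear by (auto simp: insert_commute)
  from infdist_line[OF this] show ?thesis
    by (simp add: assms(2) cross_affine_coordinates[OF assms(1)] dist_BC abs_mult)
qed

text \<open>The distance to a side is the absolute coordinate over the side length, times twice the
  area of the triangle, and this last factor cancels. The absolute values leave room for the
  incenter and the three excenters.\<close>

lemma equidistant_from_sides_iff:
  assumes sum: "p + q + r = 1" and P: "P = p *\<^sub>R A + q *\<^sub>R B + r *\<^sub>R C"
  shows "equidistant_from_sides A B C P \<longleftrightarrow>
    \<bar>p\<bar> / (y + z) = \<bar>q\<bar> / (z + x) \<and> \<bar>q\<bar> / (z + x) = \<bar>r\<bar> / (x + y)"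
proof -
  interpret t2: triangle B C A y z x by (rule rotate)
  interpret t3: triangle C A B z x y by (rule t2.rotate)
  define k where "k = \<bar>cross (B - A) (C - A)\<bar>"
  have k: "\<bar>cross (C - B) (A - B)\<bar> = k" "\<bar>cross (A - C) (B - C)\<bar> = k"
    unfolding k_def by (rule arg_cong[of _ _ abs], simp add: cross_def algebra_simps)+
  have "k \<noteq> 0" using noncollinear by (simp add: k_def collinear_iff_cross)
  have "infdist P (line B C) = \<bar>p\<bar> / (y + z) * k"
    using infdist_side[OF sum P] by (simp add: k_def)
  moreover have "infdist P (line C A) = \<bar>q\<bar> / (z + x) * k"
    using t2.infdist_side[of q r p P] sum P by (simp add: k add_ac)
  moreover have "infdist P (line A B) = \<bar>r\<bar> / (x + y) * k"
    using t3.infdist_side[of r p q P] sum P by (simp add: k add_ac)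
  ultimately show ?thesis
    using \<open>k \<noteq> 0\<close> by (simp add: equidistant_from_sides_def del: times_divide_eq_left)
qed

text \<open>Interior points have positive coordinates, so the absolute values disappear; the common
  ratio \<open>k\<close> is then fixed by the coordinate sum.\<close>

lemma incenter_eq:
  "incenter A B C = ((y + z) / (2 * (x + y + z))) *\<^sub>R A + ((z + x) / (2 * (x + y + z))) *\<^sub>R B
    + ((x + y) / (2 * (x + y + z))) *\<^sub>R C"
  (is "_ = ?I")
  unfolding incenter_def
proof (rule the_equality)
  define p q r where "p = (y + z) / (2 * (x + y + z))" and "q = (z + x) / (2 * (x + y + z))"
    and "r = (x + y) / (2 * (x + y + z))"
  have sum: "p + q + r = 1" and pqr: "p > 0" "q > 0" "r > 0"
    using pos by (simp_all add: p_def q_def r_def divide_simps)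
  have hull: "interior (convex hull {A, B, C}) =
      {v. \<exists>p q r. 0 < p \<and> 0 < q \<and> 0 < r \<and> p + q + r = 1 \<and> p *\<^sub>R A + q *\<^sub>R B + r *\<^sub>R C = v}"
    by (intro interior_convex_hull_3_minimal noncollinear) simp
  have I: "?I = p *\<^sub>R A + q *\<^sub>R B + r *\<^sub>R C" by (simp only: p_def q_def r_def)
  have "?I \<in> interior (convex hull {A, B, C})"
    unfolding hull I using sum pqr by blast
  moreover have "equidistant_from_sides A B C ?I"
    unfolding equidistant_from_sides_iff[OF sum I] using pos pqr
    by (simp add: p_def q_def r_def divide_simps)
  ultimately show "?I \<in> interior (convex hull {A, B, C}) \<and> equidistant_from_sides A B C ?I"
    by blast
  fix P assume P: "P \<in> interior (convex hull {A, B, C}) \<and> equidistant_from_sides A B C P"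
  then obtain p q r where pqr: "0 < p" "0 < q" "0 < r" "p + q + r = 1"
    and P': "P = p *\<^sub>R A + q *\<^sub>R B + r *\<^sub>R C"
    unfolding hull by blast
  have eq: "p / (y + z) = q / (z + x)" "q / (z + x) = r / (x + y)"
    using P equidistant_from_sides_iff[OF pqr(4) P'] pqr by auto
  define k where "k = p / (y + z)"
  have "p / (y + z) = k" "q / (z + x) = k" "r / (x + y) = k"
    using eq by (simp_all add: k_def)
  then have k: "p = k * (y + z)" "q = k * (z + x)" "r = k * (x + y)"
    using pos by (simp_all only: nonzero_divide_eq_eq[of "y + z"] nonzero_divide_eq_eq[of "z + x"]
        nonzero_divide_eq_eq[of "x + y"] add_pos_pos less_imp_neq[symmetric] simp_thms)
  then have "k = 1 / (2 * (x + y + z))"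
    using pqr(4) pos by (simp add: field_simps)
  then show "P = ?I" unfolding P' k by simp
qed

text \<open>The crossing condition fixes the signs, and with them the coordinate sum becomes
  \<open>k * (2 * x)\<close>.\<close>

lemma excenter_eq:
  "excenter A B C = (- ((y + z) / (2 * x))) *\<^sub>R A + ((z + x) / (2 * x)) *\<^sub>R B + ((x + y) / (2 * x)) *\<^sub>R C"
  (is "_ = ?J")
  unfolding excenter_def
proof (rule the_equality)
  have "- ((y + z) / (2 * x)) + (z + x) / (2 * x) + (x + y) / (2 * x) = 1"
    using pos by (simp add: divide_simps)
  from equidistant_from_sides_iff[OF this refl] segments_cross_iff[OF noncollinear this refl]
  show "equidistant_from_sides A B C ?J \<and> open_segment A ?J \<inter> open_segment B C \<noteq> {}"
    using pos by (simp only:) (simp add: divide_simps)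
  fix P assume P: "equidistant_from_sides A B C P \<and> open_segment A P \<inter> open_segment B C \<noteq> {}"
  obtain p q r where sum: "p + q + r = 1" and P': "P = p *\<^sub>R A + q *\<^sub>R B + r *\<^sub>R C"
    using affine_coordinates[OF noncollinear] .
  have pqr: "p < 0" "0 < q" "0 < r"
    using P segments_cross_iff[OF noncollinear sum P'] by auto
  have eq: "- p / (y + z) = q / (z + x)" "q / (z + x) = r / (x + y)"
    using P equidistant_from_sides_iff[OF sum P'] pqr by auto
  define k where "k = q / (z + x)"
  have "- p / (y + z) = k" "q / (z + x) = k" "r / (x + y) = k"
    using eq by (simp_all add: k_def)
  then have "- p = k * (y + z)" and "q = k * (z + x)" "r = k * (x + y)"
    using pos by (simp_all only: nonzero_divide_eq_eq[of "y + z"] nonzero_divide_eq_eq[of "z + x"]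
        nonzero_divide_eq_eq[of "x + y"] add_pos_pos less_imp_neq[symmetric] simp_thms)
  then have k: "p = - (k * (y + z))" "q = k * (z + x)" "r = k * (x + y)" by simp_all
  then have "k = 1 / (2 * x)"
    using sum pos by (simp add: field_simps)
  then show "P = ?J" unfolding P' k by simp
qed

text \<open>The quadratic expression is minus the power of \<open>P\<close> with respect to the
  circumcircle.\<close>

lemma on_circumcircle_iff:
  assumes "p + q + r = 1" and P: "P = p *\<^sub>R A + q *\<^sub>R B + r *\<^sub>R C"
  shows "dist (circumcenter A B C) P = dist (circumcenter A B C) A \<longleftrightarrow>
    q * r * (y + z)\<^sup>2 + r * p * (z + x)\<^sup>2 + p * q * (x + y)\<^sup>2 = 0"
proof -
  define X where "X = circumcenter A B C"
  have "dist X P = dist X A \<longleftrightarrow> (dist P X)\<^sup>2 = (dist A X)\<^sup>2"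
    by (simp add: dist_commute)
  moreover have "dist B X = dist A X" "dist C X = dist A X"
    using dist_circumcenter[OF noncollinear] by (simp_all add: X_def dist_commute)
  then have "(dist P X)\<^sup>2 = (p + q + r) * (dist A X)\<^sup>2
      - (q * r * (y + z)\<^sup>2 + r * p * (z + x)\<^sup>2 + p * q * (x + y)\<^sup>2)"
    unfolding P by (subst dist_to_combination[OF assms(1)]) (simp add: algebra_simps)
  ultimately show ?thesis using assms(1) by (auto simp: X_def)
qed

lemma mid_arc_eq:
  "mid_arc A B C = (- (y + z)\<^sup>2 / (4 * (x + y + z) * x)) *\<^sub>R A
    + ((z + x) * (2 * x + y + z) / (4 * (x + y + z) * x)) *\<^sub>R B
    + ((x + y) * (2 * x + y + z) / (4 * (x + y + z) * x)) *\<^sub>R C" (is "_ = ?D")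
  and mid_arc_on_circle: "dist (circumcenter A B C) (mid_arc A B C) = dist (circumcenter A B C) A"
proof -
  define p q r where "p = - (y + z)\<^sup>2 / (4 * (x + y + z) * x)"
    and "q = (z + x) * (2 * x + y + z) / (4 * (x + y + z) * x)"
    and "r = (x + y) * (2 * x + y + z) / (4 * (x + y + z) * x)"
  have D: "?D = p *\<^sub>R A + q *\<^sub>R B + r *\<^sub>R C" by (simp add: p_def q_def r_def)
  have neg: "p < 0" and qr_pos: "q > 0" "r > 0"
    using pos by (simp_all add: p_def q_def r_def)
  \<comment> \<open>The common denominator; multiplying by it reduces the checks to polynomial
    identities.\<close>
  define d where "d = 4 * (x + y + z) * x"
  have "d > 0" using pos by (simp add: d_def)
  have pqr: "d * p = - (y + z)\<^sup>2" "d * q = (z + x) * (2 * x + y + z)" "d * r = (x + y) * (2 * x + y + z)"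
    using \<open>d > 0\<close> unfolding p_def q_def r_def d_def[symmetric] by simp_all
  have "d * (p + q + r) = d"
    unfolding distrib_left pqr by (simp add: d_def power2_eq_square algebra_simps)
  then have sum: "p + q + r = 1" using \<open>d > 0\<close> by simp
  have "d * d * (q * r * (y + z)\<^sup>2 + r * p * (z + x)\<^sup>2 + p * q * (x + y)\<^sup>2)
      = (d * q) * (d * r) * (y + z)\<^sup>2 + (d * r) * (d * p) * (z + x)\<^sup>2 + (d * p) * (d * q) * (x + y)\<^sup>2"
    by (simp add: algebra_simps)
  also have "\<dots> = 0"
    unfolding pqr by (simp add: power2_eq_square algebra_simps)
  finally have circ: "q * r * (y + z)\<^sup>2 + r * p * (z + x)\<^sup>2 + p * q * (x + y)\<^sup>2 = 0"
    using \<open>d > 0\<close> by simp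
  have dist_eq_iff: "dist P B = dist P C \<longleftrightarrow>
      p * (x + y)\<^sup>2 + r * (y + z)\<^sup>2 = p * (z + x)\<^sup>2 + q * (y + z)\<^sup>2"
    if "p + q + r = 1" "P = p *\<^sub>R A + q *\<^sub>R B + r *\<^sub>R C" for P p q r
  proof -
    have "dist P B = dist P C \<longleftrightarrow> (dist P B)\<^sup>2 = (dist P C)\<^sup>2" by simp
    then show ?thesis
      unfolding that(2) dist_to_combination[OF that(1)]
      by (simp add: dist_AB dist_BC dist_CA dist_commute[of C B] dist_commute[of A C])
  qed
  have "d * (p * (x + y)\<^sup>2 + r * (y + z)\<^sup>2) = d * (p * (z + x)\<^sup>2 + q * (y + z)\<^sup>2)"
    unfolding distrib_left mult.assoc[symmetric] pqr by (simp add: power2_eq_square algebra_simps)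
  then have equi: "p * (x + y)\<^sup>2 + r * (y + z)\<^sup>2 = p * (z + x)\<^sup>2 + q * (y + z)\<^sup>2"
    using \<open>d > 0\<close> by simp
  have on_circle: "dist (circumcenter A B C) ?D = dist (circumcenter A B C) A"
    using on_circumcircle_iff[OF sum D] circ by simp
  show "mid_arc A B C = ?D"
    unfolding mid_arc_def
  proof (rule the_equality)
    show "?D \<in> opposite_arc A B C \<and> dist ?D B = dist ?D C"
      using on_circle segments_cross_iff[OF noncollinear sum D] neg qr_pos dist_eq_iff[OF sum D] equi
      by (simp add: opposite_arc_def)
    fix P assume P: "P \<in> opposite_arc A B C \<and> dist P B = dist P C"
    obtain p' q' r' where sum': "p' + q' + r' = 1" and P': "P = p' *\<^sub>R A + q' *\<^sub>R B + r' *\<^sub>R C"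
      using affine_coordinates[OF noncollinear] .
    have pos': "p' < 0" "0 < q'" "0 < r'"
      using P segments_cross_iff[OF noncollinear sum' P'] by (auto simp: opposite_arc_def)
    have circ': "q' * r' * (y + z)\<^sup>2 + r' * p' * (z + x)\<^sup>2 + p' * q' * (x + y)\<^sup>2 = 0"
      using P on_circumcircle_iff[OF sum' P'] by (auto simp: opposite_arc_def)
    have equi': "p' * (x + y)\<^sup>2 + r' * (y + z)\<^sup>2 = p' * (z + x)\<^sup>2 + q' * (y + z)\<^sup>2"
      using P dist_eq_iff[OF sum' P'] by simp
    \<comment> \<open>Eliminating \<open>p'\<close> leaves a difference of squares. Positivity of
      \<open>q'\<close> and \<open>r'\<close> excludes the factor that belongs to the external
      bisector at \<open>A\<close>.\<close>
    have "(y + z)\<^sup>2 * (((x + y) * q')\<^sup>2 - ((z + x) * r')\<^sup>2) = 0"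
      using circ' equi' by algebra
    then have "((x + y) * q')\<^sup>2 = ((z + x) * r')\<^sup>2" using pos by simp
    then have "(x + y) * q' = (z + x) * r'"
      using pos pos' by (simp add: power2_eq_iff_nonneg)
    then obtain k where k: "q' = k * (z + x)" "r' = k * (x + y)"
      using pos by (intro that[of "q' / (z + x)"]) (simp_all add: field_simps)
    then have "k \<noteq> 0" using pos' by auto
    have p': "p' = 1 - k * (2 * x + y + z)" using sum' k by (simp add: algebra_simps)
    \<comment> \<open>On the internal bisector the circle equation has two roots;
      \<open>k = 0\<close> is the vertex \<open>A\<close>.\<close>
    have "k * (z + x) * (x + y) * (k * d - (2 * x + y + z)) = 0"
      using circ' unfolding k p' d_def by algebra
    then have kd: "k * d = 2 * x + y + z" using \<open>k \<noteq> 0\<close> pos by simp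
    have "d * q' = d * q" "d * r' = d * r"
      unfolding pqr k kd[symmetric] by simp_all
    then have "q' = q" "r' = r" using \<open>d > 0\<close> by simp_all
    moreover from this have "p' = p" using sum sum' by simp
    ultimately show "P = ?D" unfolding D P' by simp
  qed
  then show "dist (circumcenter A B C) (mid_arc A B C) = dist (circumcenter A B C) A"
    using on_circle by simp
qed

text \<open>The classical weights: squared side times the sum of the other two squares minus its
  own. By Heron's formula the denominator is sixteen times the squared area.\<close>

lemma circumcenter_barycentric:
  "circumcenter A B C
    = ((y + z)\<^sup>2 * ((z + x)\<^sup>2 + (x + y)\<^sup>2 - (y + z)\<^sup>2) / (16 * (x + y + z) * x * y * z)) *\<^sub>R A
    + ((z + x)\<^sup>2 * ((x + y)\<^sup>2 + (y + z)\<^sup>2 - (z + x)\<^sup>2) / (16 * (x + y + z) * x * y * z)) *\<^sub>R B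
    + ((x + y)\<^sup>2 * ((y + z)\<^sup>2 + (z + x)\<^sup>2 - (x + y)\<^sup>2) / (16 * (x + y + z) * x * y * z)) *\<^sub>R C"
  (is "_ = ?p *\<^sub>R A + ?q *\<^sub>R B + ?r *\<^sub>R C")
proof -
  define d where "d = 16 * (x + y + z) * x * y * z"
  have "d > 0" using pos by (simp add: d_def)
  define p q r where "p = ?p" and "q = ?q" and "r = ?r"
  have pqr: "d * p = (y + z)\<^sup>2 * ((z + x)\<^sup>2 + (x + y)\<^sup>2 - (y + z)\<^sup>2)"
    "d * q = (z + x)\<^sup>2 * ((x + y)\<^sup>2 + (y + z)\<^sup>2 - (z + x)\<^sup>2)"
    "d * r = (x + y)\<^sup>2 * ((y + z)\<^sup>2 + (z + x)\<^sup>2 - (x + y)\<^sup>2)"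
    using \<open>d > 0\<close> unfolding p_def q_def r_def d_def[symmetric] by simp_all
  have "d * (p + q + r) = d"
    unfolding distrib_left pqr by (simp add: d_def power2_eq_square algebra_simps)
  then have sum: "p + q + r = 1" using \<open>d > 0\<close> by simp
  have "d * (q * (x + y)\<^sup>2 + r * (z + x)\<^sup>2) = d * (p * (x + y)\<^sup>2 + r * (y + z)\<^sup>2)"
    "d * (q * (x + y)\<^sup>2 + r * (z + x)\<^sup>2) = d * (p * (z + x)\<^sup>2 + q * (y + z)\<^sup>2)"
    unfolding distrib_left mult.assoc[symmetric] pqr by algebra+
  then have eq: "q * (x + y)\<^sup>2 + r * (z + x)\<^sup>2 = p * (x + y)\<^sup>2 + r * (y + z)\<^sup>2"
    "q * (x + y)\<^sup>2 + r * (z + x)\<^sup>2 = p * (z + x)\<^sup>2 + q * (y + z)\<^sup>2"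
    using \<open>d > 0\<close> by simp_all
  define P where "P = p *\<^sub>R A + q *\<^sub>R B + r *\<^sub>R C"
  have "(dist P A)\<^sup>2 = (dist P B)\<^sup>2" "(dist P A)\<^sup>2 = (dist P C)\<^sup>2"
    using eq unfolding P_def dist_to_combination[OF sum]
    by (simp_all add: dist_AB dist_BC dist_CA dist_commute[of B A] dist_commute[of C B] dist_commute[of A C])
  then have "circumcenter A B C = P"
    using noncollinear by (intro circumcenter_unique) simp_all
  then show ?thesis by (simp add: P_def p_def q_def r_def)
qed

end

section \<open>The mid-arc triangle\<close>

text \<open>The area of \<open>A B C\<close> is a multiple of the area of \<open>D E F\<close>, so
  it would vanish together with the latter.\<close>

lemma noncollinear_affine_combinations:
  fixes A B C D E F :: "real^2"
  assumes nc: "\<not> collinear {A, B, C}"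
    and A: "A = p *\<^sub>R D + q *\<^sub>R E + r *\<^sub>R F" "p + q + r = 1"
    and B: "B = p' *\<^sub>R D + q' *\<^sub>R E + r' *\<^sub>R F" "p' + q' + r' = 1"
    and C: "C = p'' *\<^sub>R D + q'' *\<^sub>R E + r'' *\<^sub>R F" "p'' + q'' + r'' = 1"
  shows "\<not> collinear {D, E, F}"
proof -
  have p: "p = 1 - q - r" "p' = 1 - q' - r'" "p'' = 1 - q'' - r''" using A B C by simp_all
  have "B - A = (q' - q) *\<^sub>R (E - D) + (r' - r) *\<^sub>R (F - D)"
    "C - A = (q'' - q) *\<^sub>R (E - D) + (r'' - r) *\<^sub>R (F - D)"
    unfolding A(1) B(1) C(1) p by (simp_all add: algebra_simps)
  then show ?thesis
    using nc by (simp add: collinear_iff_cross cross_combination)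
qed

lemma circumcenter_rotate:
  assumes "\<not> collinear {A, B, C}"
  shows "circumcenter B C A = circumcenter A B C"
  using assms dist_circumcenter[OF assms]
  by (intro circumcenter_unique) (simp_all add: insert_commute)

text \<open>The direction is orthocenter minus circumcenter. The parametrization remains valid when
  it is zero.\<close>

lemma mem_euler_line_iff:
  assumes "\<not> collinear {A, B, C}"
  shows "X \<in> euler_line A B C \<longleftrightarrow>
    (\<exists>t. X = circumcenter A B C + t *\<^sub>R (A + B + C - 3 *\<^sub>R circumcenter A B C))"
proof -
  define P where "P = circumcenter A B C"
  have eq: "A + B + C - 2 *\<^sub>R P - P = A + B + C - 3 *\<^sub>R P"
    by (simp add: vec_eq_iff)
  show ?thesis
    unfolding euler_line_def orthocenter_eq[OF assms] affine_hull_2_alt P_def[symmetric] eq by auto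
qed

context triangle
begin

lemma incenter_rotate: "incenter B C A = incenter A B C"
  unfolding incenter_eq triangle.incenter_eq[OF rotate] by (simp add: add_ac)

lemma mid_arc_B:
  "mid_arc B C A = ((y + z) * (x + 2 * y + z) / (4 * (x + y + z) * y)) *\<^sub>R A
    + (- (z + x)\<^sup>2 / (4 * (x + y + z) * y)) *\<^sub>R B
    + ((x + y) * (x + 2 * y + z) / (4 * (x + y + z) * y)) *\<^sub>R C"
  unfolding triangle.mid_arc_eq[OF rotate] by (simp only: ac_simps)

lemma mid_arc_C:
  "mid_arc C A B = ((y + z) * (x + y + 2 * z) / (4 * (x + y + z) * z)) *\<^sub>R A
    + ((z + x) * (x + y + 2 * z) / (4 * (x + y + z) * z)) *\<^sub>R B
    + (- (x + y)\<^sup>2 / (4 * (x + y + z) * z)) *\<^sub>R C"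
  unfolding triangle.mid_arc_eq[OF triangle.rotate[OF rotate]] by (simp only: ac_simps)

text \<open>The arc midpoint bisects the segment from incenter to excenter; this is the homothety
  with center \<open>I\<close> and ratio 2.\<close>

lemma excenter_mid_arc: "excenter A B C = 2 *\<^sub>R mid_arc A B C - incenter A B C"
proof -
  \<comment> \<open>The zero term pads the sum to the three-term shape of
    \<open>add_scaleR_combinations\<close>.\<close>
  have "2 *\<^sub>R mid_arc A B C + (- 1) *\<^sub>R incenter A B C + 0 *\<^sub>R incenter A B C = excenter A B C"
    unfolding mid_arc_eq incenter_eq excenter_eq add_scaleR_combinations
    by (rule combination_cong) (use pos in \<open>simp add: divide_simps; algebra\<close>)+
  then show ?thesis by simp
qed

text \<open>The angle of the mid-arc triangle at its first vertex is half the sum of the angles at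
  \<open>B\<close> and \<open>C\<close>. The sine of its double is the sine of the angle at
  \<open>A\<close>, hence the weight \<open>y + z\<close>.\<close>

lemma circumcenter_eq:
  "circumcenter A B C = ((y + z) / (2 * (x + y + z))) *\<^sub>R mid_arc A B C
    + ((z + x) / (2 * (x + y + z))) *\<^sub>R mid_arc B C A + ((x + y) / (2 * (x + y + z))) *\<^sub>R mid_arc C A B"
  unfolding mid_arc_eq mid_arc_B mid_arc_C circumcenter_barycentric add_scaleR_combinations
  by (rule combination_cong) (use pos in \<open>simp add: divide_simps; algebra\<close>)+

text \<open>These are the orthocenter weights of the mid-arc triangle: the tangent of its first
  angle is the cotangent of half the angle at \<open>A\<close>, proportional to
  \<open>x\<close>.\<close>

lemma incenter_mid_arcs:
  "incenter A B C = (x / (x + y + z)) *\<^sub>R mid_arc A B C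
    + (y / (x + y + z)) *\<^sub>R mid_arc B C A + (z / (x + y + z)) *\<^sub>R mid_arc C A B"
  unfolding mid_arc_eq mid_arc_B mid_arc_C incenter_eq add_scaleR_combinations
  by (rule combination_cong) (use pos in \<open>simp add: divide_simps; algebra\<close>)+

text \<open>Inverts the formulas for the arc midpoints, so that the mid-arc triangle can serve as
  reference triangle. The first coordinate is opposite to that of the incenter, since
  \<open>A\<close> is its reflection in a side of the mid-arc triangle.\<close>

lemma vertex_A:
  "A = (- x / (x + y + z)) *\<^sub>R mid_arc A B C
    + (y * (2 * x + y + z) / ((y + z) * (x + y + z))) *\<^sub>R mid_arc B C A
    + (z * (2 * x + y + z) / ((y + z) * (x + y + z))) *\<^sub>R mid_arc C A B" (is "_ = ?A")
proof -
  have "?A = 1 *\<^sub>R A + 0 *\<^sub>R B + 0 *\<^sub>R C"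
    unfolding mid_arc_eq mid_arc_B mid_arc_C add_scaleR_combinations
    by (rule combination_cong) (use pos in \<open>simp add: divide_simps; algebra\<close>)+
  then show ?thesis by simp
qed

lemma vertex_B:
  "B = (x * (x + 2 * y + z) / ((z + x) * (x + y + z))) *\<^sub>R mid_arc A B C
    + (- y / (x + y + z)) *\<^sub>R mid_arc B C A
    + (z * (x + 2 * y + z) / ((z + x) * (x + y + z))) *\<^sub>R mid_arc C A B"
  by (subst triangle.vertex_A[OF rotate]) (simp only: ac_simps)

lemma vertex_C:
  "C = (x * (x + y + 2 * z) / ((x + y) * (x + y + z))) *\<^sub>R mid_arc A B C
    + (y * (x + y + 2 * z) / ((x + y) * (x + y + z))) *\<^sub>R mid_arc B C A
    + (- z / (x + y + z)) *\<^sub>R mid_arc C A B"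
  by (subst triangle.vertex_A[OF triangle.rotate[OF rotate]]) (simp only: ac_simps)

lemma noncollinear_mid_arcs: "\<not> collinear {mid_arc A B C, mid_arc B C A, mid_arc C A B}"
  by (rule noncollinear_affine_combinations[OF noncollinear vertex_A _ vertex_B _ vertex_C])
    (use pos in \<open>simp add: divide_simps; algebra\<close>)+

lemma circumcenter_mid_arcs:
  "circumcenter (mid_arc A B C) (mid_arc B C A) (mid_arc C A B) = circumcenter A B C"
proof (rule circumcenter_unique[OF noncollinear_mid_arcs])
  interpret t2: triangle B C A y z x by (rule rotate)
  interpret t3: triangle C A B z x y by (rule t2.rotate)
  have rot: "circumcenter B C A = circumcenter A B C" "circumcenter C A B = circumcenter A B C"
    using circumcenter_rotate[OF noncollinear] circumcenter_rotate[OF t2.noncollinear] by simp_all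
  show "dist (circumcenter A B C) (mid_arc A B C) = dist (circumcenter A B C) (mid_arc B C A)"
    "dist (circumcenter A B C) (mid_arc A B C) = dist (circumcenter A B C) (mid_arc C A B)"
    using mid_arc_on_circle t2.mid_arc_on_circle t3.mid_arc_on_circle dist_circumcenter[OF noncollinear]
    by (simp_all add: rot)
qed

text \<open>By Sylvester's relation each coordinate is one minus twice that of the
  circumcenter.\<close>

lemma orthocenter_mid_arcs:
  "orthocenter (mid_arc A B C) (mid_arc B C A) (mid_arc C A B) = incenter A B C"
proof -
  define p q r where "p = (y + z) / (2 * (x + y + z))" and "q = (z + x) / (2 * (x + y + z))"
    and "r = (x + y) / (2 * (x + y + z))"
  have "1 - 2 * p = x / (x + y + z)" "1 - 2 * q = y / (x + y + z)" "1 - 2 * r = z / (x + y + z)"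
    using pos by (simp_all add: p_def q_def r_def divide_simps)
  moreover have "orthocenter (mid_arc A B C) (mid_arc B C A) (mid_arc C A B)
      = (1 - 2 * p) *\<^sub>R mid_arc A B C + (1 - 2 * q) *\<^sub>R mid_arc B C A + (1 - 2 * r) *\<^sub>R mid_arc C A B"
    unfolding orthocenter_eq[OF noncollinear_mid_arcs] circumcenter_mid_arcs circumcenter_eq
      p_def[symmetric] q_def[symmetric] r_def[symmetric]
    by (simp add: algebra_simps)
  ultimately show ?thesis unfolding incenter_mid_arcs by simp
qed

lemma noncollinear_incenter_side: "\<not> collinear {incenter A B C, B, C}"
proof -
  have "cross (B - incenter A B C) (C - incenter A B C)
      = (y + z) / (2 * (x + y + z)) * cross (B - A) (C - A)"
    unfolding incenter_eq using pos by (intro cross_affine_coordinates) (simp add: divide_simps)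
  then show ?thesis
    using noncollinear pos by (simp add: collinear_iff_cross)
qed

lemma circumcenter_incenter_side: "circumcenter (incenter A B C) B C = mid_arc A B C"
proof (rule circumcenter_unique[OF noncollinear_incenter_side])
  define D where "D = mid_arc A B C"
  \<comment> \<open>With \<alpha> the angle at \<open>A\<close>, \<open>k\<close> is 1 / (4 cos^2
    (\<alpha> / 2)). The squared distance from \<open>D\<close> to \<open>B\<close>,
    \<open>C\<close> and the incenter is \<open>k * (y + z)\<^sup>2\<close>; the distance to
    \<open>A\<close> then agrees with Ptolemy's theorem.\<close>
  define k where "k = (z + x) * (x + y) / (4 * (x + y + z) * x)"
  have sum: "- (y + z)\<^sup>2 / (4 * (x + y + z) * x) + (z + x) * (2 * x + y + z) / (4 * (x + y + z) * x)
    + (x + y) * (2 * x + y + z) / (4 * (x + y + z) * x) = 1"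
    using pos by (simp add: divide_simps; algebra)
  note dist_D = dist_to_combination[OF sum, folded mid_arc_eq D_def]
  have dA: "(dist A D)\<^sup>2 = k * (2 * x + y + z)\<^sup>2"
    unfolding dist_commute[of A D] dist_D using pos
    by (simp add: dist_AB dist_BC dist_CA dist_commute[of B A] dist_commute[of C B] dist_commute[of A C]
        k_def divide_simps; algebra)
  have dB: "(dist B D)\<^sup>2 = k * (y + z)\<^sup>2"
    unfolding dist_commute[of B D] dist_D using pos
    by (simp add: dist_AB dist_BC dist_CA dist_commute[of B A] dist_commute[of C B] dist_commute[of A C]
        k_def divide_simps; algebra)
  have dC: "(dist C D)\<^sup>2 = k * (y + z)\<^sup>2"
    unfolding dist_commute[of C D] dist_D using pos
    by (simp add: dist_AB dist_BC dist_CA dist_commute[of B A] dist_commute[of C B] dist_commute[of A C]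
        k_def divide_simps; algebra)
  have sum_I: "(y + z) / (2 * (x + y + z)) + (z + x) / (2 * (x + y + z)) + (x + y) / (2 * (x + y + z)) = 1"
    using pos by (simp add: divide_simps)
  have "(dist (incenter A B C) D)\<^sup>2 = k * (y + z)\<^sup>2"
    unfolding incenter_eq dist_to_combination[OF sum_I] dA dB dC using pos
    by (simp add: k_def divide_simps; algebra)
  then have "(dist D (incenter A B C))\<^sup>2 = (dist D B)\<^sup>2" "(dist D (incenter A B C))\<^sup>2 = (dist D C)\<^sup>2"
    using dB dC by (simp_all add: dist_commute)
  then show "dist (mid_arc A B C) (incenter A B C) = dist (mid_arc A B C) B"
    "dist (mid_arc A B C) (incenter A B C) = dist (mid_arc A B C) C"
    by (simp_all add: D_def)
qed

end

section \<open>The Schiffler point\<close>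

lemma sum_minus_combination:
  assumes "A = a *\<^sub>R D + a' *\<^sub>R E + a'' *\<^sub>R F" "B = b *\<^sub>R D + b' *\<^sub>R E + b'' *\<^sub>R F"
    and "C = c *\<^sub>R D + c' *\<^sub>R E + c'' *\<^sub>R F" "P = p *\<^sub>R D + p' *\<^sub>R E + p'' *\<^sub>R F"
  shows "A + B + C - 3 *\<^sub>R P = (a + b + c - 3 * p) *\<^sub>R D + (a' + b' + c' - 3 * p') *\<^sub>R E
    + (a'' + b'' + c'' - 3 * p'') *\<^sub>R (F :: 'a::real_vector)"
  unfolding assms by (simp add: algebra_simps)

lemma point_plus_direction:
  "(p *\<^sub>R D + q *\<^sub>R E + r *\<^sub>R F) + t *\<^sub>R (p' *\<^sub>R D + q' *\<^sub>R E + r' *\<^sub>R F)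
    = (p + t * p') *\<^sub>R D + (q + t * q') *\<^sub>R E + (r + t * r') *\<^sub>R (F :: 'a::real_vector)"
  by (simp add: algebra_simps)

context triangle
begin

text \<open>Times \<open>x + y + z\<close>, this is the sum of the numerators in
  \<open>schiffler_combination\<close>, so the coordinates there sum to one.\<close>

definition schiffler_den :: real where
  "schiffler_den = 3 * (y + z) * (z + x) * (x + y) + 8 * x * y * z"

text \<open>The weights \<open>x * (y + z) / (2 * x + y + z)\<close> and their rotations, with
  denominators cleared and the sum normalized.\<close>

definition schiffler_combination :: "real^2" where
  "schiffler_combination =
    (x * (y + z) * (x + 2 * y + z) * (x + y + 2 * z) / ((x + y + z) * schiffler_den)) *\<^sub>R mid_arc A B C
    + (y * (z + x) * (2 * x + y + z) * (x + y + 2 * z) / ((x + y + z) * schiffler_den)) *\<^sub>R mid_arc B C A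
    + (z * (x + y) * (2 * x + y + z) * (x + 2 * y + z) / ((x + y + z) * schiffler_den)) *\<^sub>R mid_arc C A B"

lemma schiffler_den_pos: "schiffler_den > 0"
  using pos by (simp add: schiffler_den_def add_pos_pos)

lemma schiffler_combination_rotate:
  "triangle.schiffler_combination B C A y z x = schiffler_combination"
proof -
  have "triangle.schiffler_den y z x = schiffler_den"
    unfolding schiffler_den_def triangle.schiffler_den_def[OF rotate] by (simp only: ac_simps)
  then show ?thesis
    unfolding schiffler_combination_def triangle.schiffler_combination_def[OF rotate]
    by (simp only: ac_simps)
qed

lemma mid_arc_trivial:
  "mid_arc A B C = 1 *\<^sub>R mid_arc A B C + 0 *\<^sub>R mid_arc B C A + 0 *\<^sub>R mid_arc C A B"
  by simp

lemmas euler_direction =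
  sum_minus_combination[OF vertex_A vertex_B vertex_C circumcenter_eq]
lemmas euler_direction_incenter =
  sum_minus_combination[OF incenter_mid_arcs vertex_B vertex_C mid_arc_trivial]

lemma schiffler_combination_eq_A:
  "schiffler_combination = circumcenter A B C
    + ((y + z) * (z + x) * (x + y) / schiffler_den) *\<^sub>R (A + B + C - 3 *\<^sub>R circumcenter A B C)"
  unfolding euler_direction
  unfolding circumcenter_eq point_plus_direction schiffler_combination_def
  by (rule combination_cong)
    (use pos schiffler_den_pos in \<open>simp add: divide_simps, simp add: schiffler_den_def; algebra\<close>)+

lemma schiffler_combination_eq_incenter:
  "schiffler_combination = mid_arc A B C
    + ((z + x) * (x + y) * (2 * x + y + z) / schiffler_den) *\<^sub>R (incenter A B C + B + C - 3 *\<^sub>R mid_arc A B C)"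
proof -
  have "(1 *\<^sub>R mid_arc A B C + 0 *\<^sub>R mid_arc B C A + 0 *\<^sub>R mid_arc C A B)
    + ((z + x) * (x + y) * (2 * x + y + z) / schiffler_den) *\<^sub>R (incenter A B C + B + C - 3 *\<^sub>R mid_arc A B C)
    = schiffler_combination"
    unfolding euler_direction_incenter
    unfolding point_plus_direction schiffler_combination_def
    by (rule combination_cong)
      (use pos schiffler_den_pos in \<open>simp add: divide_simps, (simp add: schiffler_den_def; algebra)?\<close>)+
  then show ?thesis by simp
qed


lemma schiffler_combination_on_euler_lines:
  "schiffler_combination \<in> euler_line A B C" "schiffler_combination \<in> euler_line (incenter A B C) B C"
  unfolding mem_euler_line_iff[OF noncollinear] mem_euler_line_iff[OF noncollinear_incenter_side]
    circumcenter_incenter_side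
  using schiffler_combination_eq_A schiffler_combination_eq_incenter by blast+

text \<open>For \<open>y = z\<close> both Euler lines lie on the axis of symmetry through
  \<open>A\<close>; otherwise equating coordinates determines the parameter
  \<open>t\<close>.\<close>

lemma euler_lines_meet:
  assumes "y \<noteq> z" and T: "T \<in> euler_line A B C" "T \<in> euler_line (incenter A B C) B C"
  shows "T = schiffler_combination"
proof -
  obtain t s where t: "T = circumcenter A B C + t *\<^sub>R (A + B + C - 3 *\<^sub>R circumcenter A B C)"
    and s: "T = mid_arc A B C + s *\<^sub>R (incenter A B C + B + C - 3 *\<^sub>R mid_arc A B C)"
    using T unfolding mem_euler_line_iff[OF noncollinear] mem_euler_line_iff[OF noncollinear_incenter_side]
      circumcenter_incenter_side by blast
  \<comment> \<open>The directions are abstracted to coordinates with zero sum and relations free of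
    denominators, so that only polynomial algebra remains.\<close>
  obtain v\<^sub>1 v\<^sub>2 v\<^sub>3 where v: "A + B + C - 3 *\<^sub>R circumcenter A B C
      = v\<^sub>1 *\<^sub>R mid_arc A B C + v\<^sub>2 *\<^sub>R mid_arc B C A + v\<^sub>3 *\<^sub>R mid_arc C A B"
    and sum_v: "v\<^sub>1 + v\<^sub>2 + v\<^sub>3 = 0"
    and v2: "2 * (y + z) * (x + y) * (x + y + z) * v\<^sub>2 = 2 * y * (2 * x + y + z) * (x + y)
      - 2 * y * (y + z) * (x + y) + 2 * y * (x + y + 2 * z) * (y + z) - 3 * (y + z) * (z + x) * (x + y)"
    and v3: "2 * (y + z) * (z + x) * (x + y + z) * v\<^sub>3 = 2 * z * (2 * x + y + z) * (z + x)
      - 2 * z * (y + z) * (z + x) + 2 * z * (x + 2 * y + z) * (y + z) - 3 * (y + z) * (z + x) * (x + y)"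
    by (rule that[OF euler_direction])
      (use pos in \<open>simp add: divide_simps, simp add: algebra_simps\<close>)+
  obtain w\<^sub>1 w\<^sub>2 w\<^sub>3 where w: "incenter A B C + B + C - 3 *\<^sub>R mid_arc A B C
      = w\<^sub>1 *\<^sub>R mid_arc A B C + w\<^sub>2 *\<^sub>R mid_arc B C A + w\<^sub>3 *\<^sub>R mid_arc C A B"
    and sum_w: "w\<^sub>1 + w\<^sub>2 + w\<^sub>3 = 0"
    and w2: "(x + y) * (x + y + z) * w\<^sub>2 = y * (x + y + 2 * z)"
    and w3: "(z + x) * (x + y + z) * w\<^sub>3 = z * (x + 2 * y + z)"
  proof (rule that[OF euler_direction_incenter], goal_cases)
    case 1
    then show ?case using pos by (simp add: divide_simps) (simp add: algebra_simps)
  next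
    case 2
    then show ?case using pos by simp
  next
    case 3
    then show ?case using pos by simp
  qed
  define p q r where "p = (y + z) / (2 * (x + y + z))" and "q = (z + x) / (2 * (x + y + z))"
    and "r = (x + y) / (2 * (x + y + z))"
  have sum_pqr: "p + q + r = 1" and q: "2 * (x + y + z) * q = z + x" and r: "2 * (x + y + z) * r = x + y"
    using pos by (simp_all add: p_def q_def r_def divide_simps)
  have "(p *\<^sub>R mid_arc A B C + q *\<^sub>R mid_arc B C A + r *\<^sub>R mid_arc C A B)
      + t *\<^sub>R (A + B + C - 3 *\<^sub>R circumcenter A B C)
    = (1 *\<^sub>R mid_arc A B C + 0 *\<^sub>R mid_arc B C A + 0 *\<^sub>R mid_arc C A B)
      + s *\<^sub>R (incenter A B C + B + C - 3 *\<^sub>R mid_arc A B C)"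
    unfolding p_def q_def r_def circumcenter_eq[symmetric] using s t by simp
  note eq = this[unfolded v w point_plus_direction]
  have "(p + t * v\<^sub>1) + (q + t * v\<^sub>2) + (r + t * v\<^sub>3) = (1 + s * w\<^sub>1) + (0 + s * w\<^sub>2) + (0 + s * w\<^sub>3)"
    using sum_v sum_w sum_pqr by algebra
  then have "q + t * v\<^sub>2 = s * w\<^sub>2" "r + t * v\<^sub>3 = s * w\<^sub>3"
    using affine_coordinates_unique(2,3)[OF noncollinear_mid_arcs eq] by simp_all
  then have "(y + z) * (x + y) * (2 * (x + y + z) * q) + t * (2 * (y + z) * (x + y) * (x + y + z) * v\<^sub>2)
      = 2 * (y + z) * s * ((x + y) * (x + y + z) * w\<^sub>2)"
    "(y + z) * (z + x) * (2 * (x + y + z) * r) + t * (2 * (y + z) * (z + x) * (x + y + z) * v\<^sub>3)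
      = 2 * (y + z) * s * ((z + x) * (x + y + z) * w\<^sub>3)"
    by algebra+
  then have 1: "(y + z) * (z + x) * (x + y) + t * (2 * y * (2 * x + y + z) * (x + y)
      - 2 * y * (y + z) * (x + y) + 2 * y * (x + y + 2 * z) * (y + z) - 3 * (y + z) * (z + x) * (x + y))
      = 2 * (y + z) * s * (y * (x + y + 2 * z))"
    and 2: "(y + z) * (z + x) * (x + y) + t * (2 * z * (2 * x + y + z) * (z + x)
      - 2 * z * (y + z) * (z + x) + 2 * z * (x + 2 * y + z) * (y + z) - 3 * (y + z) * (z + x) * (x + y))
      = 2 * (y + z) * s * (z * (x + 2 * y + z))"
    unfolding v2 v3 w2 w3 q r by (simp_all only: ac_simps)
  \<comment> \<open>Eliminates \<open>s\<close>: each equation is multiplied by the coefficient of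
    \<open>s\<close> in the other, up to a common factor, and the difference of the left sides
    contains the factor \<open>z - y\<close>.\<close>
  have "(z - y) * (x + y + z) * ((y + z) * (z + x) * (x + y) - t * schiffler_den)
    = z * (x + 2 * y + z) * (2 * (y + z) * s * (y * (x + y + 2 * z)))
      - y * (x + y + 2 * z) * (2 * (y + z) * s * (z * (x + 2 * y + z)))"
    unfolding 1[symmetric] 2[symmetric] schiffler_den_def by algebra
  then have "(z - y) * (x + y + z) * ((y + z) * (z + x) * (x + y) - t * schiffler_den) = 0"
    by simp
  moreover have "z - y \<noteq> 0" "x + y + z \<noteq> 0" using \<open>y \<noteq> z\<close> pos by simp_all
  ultimately have "(y + z) * (z + x) * (x + y) - t * schiffler_den = 0"
    unfolding mult_eq_0_iff by blast
  then have "t = (y + z) * (z + x) * (x + y) / schiffler_den"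
    using schiffler_den_pos by (simp add: eq_divide_eq)
  then show ?thesis
    unfolding t schiffler_combination_eq_A by simp
qed

text \<open>Here circumcenter and orthocenter coincide, and the Euler line shrinks to a
  point.\<close>

lemma euler_line_equilateral:
  assumes "x = y" "y = z" and T: "T \<in> euler_line A B C"
  shows "T = schiffler_combination"
proof -
  have "A + B + C - 3 *\<^sub>R circumcenter A B C = 0 *\<^sub>R mid_arc A B C + 0 *\<^sub>R mid_arc B C A + 0 *\<^sub>R mid_arc C A B"
    unfolding euler_direction by (rule combination_cong) (use assms(1,2) pos in \<open>simp add: divide_simps\<close>)+
  then show ?thesis
    using T unfolding mem_euler_line_iff[OF noncollinear] schiffler_combination_eq_A by auto
qed

lemma euler_line_rotate: "euler_line B C A = euler_line A B C"
  unfolding euler_line_def orthocenter_eq[OF noncollinear] orthocenter_eq[OF triangle.noncollinear[OF rotate]]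
    circumcenter_rotate[OF noncollinear] by (simp add: add_ac)

lemma schiffler_point_eq: "schiffler_point A B C = schiffler_combination"
proof -
  interpret t2: triangle B C A y z x by (rule rotate)
  interpret t3: triangle C A B z x y by (rule t2.rotate)
  have rot: "euler_line B C A = euler_line A B C" "euler_line C A B = euler_line A B C"
    "incenter B C A = incenter A B C" "incenter C A B = incenter A B C"
    "t2.schiffler_combination = schiffler_combination" "t3.schiffler_combination = schiffler_combination"
    by (simp_all add: euler_line_rotate t2.euler_line_rotate incenter_rotate t2.incenter_rotate
        schiffler_combination_rotate t2.schiffler_combination_rotate)
  show ?thesis
    unfolding schiffler_point_def Let_def
  proof (rule the_equality)
    show "schiffler_combination \<in> euler_line A B C \<and> schiffler_combination \<in> euler_line (incenter A B C) B C \<and>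
      schiffler_combination \<in> euler_line (incenter A B C) C A \<and>
      schiffler_combination \<in> euler_line (incenter A B C) A B"
      using schiffler_combination_on_euler_lines t2.schiffler_combination_on_euler_lines
        t3.schiffler_combination_on_euler_lines by (simp only: rot simp_thms)
    fix T assume T: "T \<in> euler_line A B C \<and> T \<in> euler_line (incenter A B C) B C \<and>
      T \<in> euler_line (incenter A B C) C A \<and> T \<in> euler_line (incenter A B C) A B"
    \<comment> \<open>Unless the triangle is equilateral, some vertex joins two unequal sides, and
      the Euler lines meet in one point for the side opposite to it.\<close>
    consider "y \<noteq> z" | "z \<noteq> x" | "x = y" "y = z" by blast
    then show "T = schiffler_combination"
    proof cases
      case 1
      then show ?thesis using euler_lines_meet T by blast
    next
      case 2
      then show ?thesis using t2.euler_lines_meet[of T] T by (simp only: rot simp_thms)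
    next
      case 3
      then show ?thesis using euler_line_equilateral T by blast
    qed
  qed
qed

end

section \<open>Hyperbolas through the vertices of a triangle\<close>

lemma orthonormal_inner_expansion:
  fixes u v w w' :: "real^2"
  assumes "norm u = 1" "norm v = 1" "orthogonal u v"
  shows "w \<bullet> w' = (w \<bullet> u) * (w' \<bullet> u) + (w \<bullet> v) * (w' \<bullet> v)"
proof -
  have uv: "u \<bullet> u = 1" "v \<bullet> v = 1" "u \<bullet> v = 0" "v \<bullet> u = 0"
    using assms by (simp_all add: norm_eq_1 orthogonal_def inner_commute)
  have "w - ((w \<bullet> u) *\<^sub>R u + (w \<bullet> v) *\<^sub>R v) = 0"
  proof (rule orthogonal_to_basis_eq_0)
    show "cross u v \<noteq> 0" using cross_squared[of u v] uv by auto
  qed (simp_all add: inner_diff_left inner_add_left uv)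
  then have "w = (w \<bullet> u) *\<^sub>R u + (w \<bullet> v) *\<^sub>R v" by simp
  then have "w \<bullet> w' = ((w \<bullet> u) *\<^sub>R u + (w \<bullet> v) *\<^sub>R v) \<bullet> w'" by simp
  then show ?thesis
    by (simp only: inner_add_left inner_scaleR_left inner_commute[of u w'] inner_commute[of v w'])
qed

text \<open>The quadratic part of the equation. It takes difference vectors and does not involve the
  center \<open>Z\<close>.\<close>

definition hyperbola_form :: "real^2 \<Rightarrow> real^2 \<Rightarrow> real \<Rightarrow> real \<Rightarrow> real^2 \<Rightarrow> real" where
  "hyperbola_form u v a b w = (w \<bullet> u)\<^sup>2 / a\<^sup>2 - (w \<bullet> v)\<^sup>2 / b\<^sup>2"

text \<open>Stewart's expansion with the quadratic form in place of the squared norm. The form,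
  taken from \<open>Z\<close>, is 1 at the vertices, so only the mixed terms decide.\<close>

lemma circumconic_iff:
  assumes H: "has_hyperbola_equation \<H> Z u v a b" and DEF: "D \<in> \<H>" "E \<in> \<H>" "F \<in> \<H>"
    and sum: "p + q + r = 1"
  shows "p *\<^sub>R D + q *\<^sub>R E + r *\<^sub>R F \<in> \<H> \<longleftrightarrow>
    q * r * hyperbola_form u v a b (E - F) + r * p * hyperbola_form u v a b (F - D)
      + p * q * hyperbola_form u v a b (D - E) = 0"
proof -
  define i j where "i = 1 / a\<^sup>2" and "j = 1 / b\<^sup>2"
  let ?g = "hyperbola_form u v a b"
  have g: "?g w = i * (w \<bullet> u)\<^sup>2 - j * (w \<bullet> v)\<^sup>2" for w
    by (simp add: hyperbola_form_def i_def j_def)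
  have mem: "P \<in> \<H> \<longleftrightarrow> ?g (P - Z) = 1" for P
    using H by (simp add: has_hyperbola_equation_def hyperbola_form_def)
  have on: "?g (D - Z) = 1" "?g (E - Z) = 1" "?g (F - Z) = 1"
    using DEF by (simp_all add: mem)
  have p: "p = 1 - q - r" using sum by simp
  have "?g (p *\<^sub>R D + q *\<^sub>R E + r *\<^sub>R F - Z) = p * ?g (D - Z) + q * ?g (E - Z) + r * ?g (F - Z)
    - (q * r * ?g (E - F) + r * p * ?g (F - D) + p * q * ?g (D - E))"
    unfolding g p inner_diff_left inner_add_left inner_scaleR_left by algebra
  also have "\<dots> = 1 - (q * r * ?g (E - F) + r * p * ?g (F - D) + p * q * ?g (D - E))"
    unfolding on using sum by simp
  finally show ?thesis
    unfolding mem by (intro iffI; linarith)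
qed

text \<open>In terms of the sides \<open>e\<^sub>1, e\<^sub>2, e\<^sub>3\<close> of the triangle, the trace of a quadratic form \<open>g\<close> is a
  multiple of the sum of the \<open>(e\<^sub>i \<bullet> e\<^sub>j) * g e\<^sub>k\<close>, and the barycentric coordinates of the
  orthocenter are inversely proportional to the \<open>e\<^sub>i \<bullet> e\<^sub>j\<close>.\<close>

lemma rectangular_through_orthocenter:
  assumes H: "has_hyperbola_equation \<H> Z u v a b" and DEF: "D \<in> \<H>" "E \<in> \<H>" "F \<in> \<H>"
    and nc: "\<not> collinear {D, E, F}" and sum: "p + q + r = 1" and pqr: "p \<noteq> 0" "q \<noteq> 0" "r \<noteq> 0"
    and orth: "orthocenter D E F = p *\<^sub>R D + q *\<^sub>R E + r *\<^sub>R F" "orthocenter D E F \<in> \<H>"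
  shows "a = b"
proof -
  let ?g = "hyperbola_form u v a b"
  have uv: "norm u = 1" "norm v = 1" "orthogonal u v" and ab: "a > 0" "b > 0"
    using H by (auto simp: has_hyperbola_equation_def)
  define i j where "i = 1 / a\<^sup>2" and "j = 1 / b\<^sup>2"
  have g: "?g w = i * (w \<bullet> u)\<^sup>2 - j * (w \<bullet> v)\<^sup>2" for w
    by (simp add: hyperbola_form_def i_def j_def)
  define e\<^sub>1 e\<^sub>2 e\<^sub>3 where "e\<^sub>1 = E - F" and "e\<^sub>2 = F - D" and "e\<^sub>3 = D - E"
  have conic: "q * r * ?g e\<^sub>1 + r * p * ?g e\<^sub>2 + p * q * ?g e\<^sub>3 = 0"
    using circumconic_iff[OF H DEF sum] orth by (simp add: e\<^sub>1_def e\<^sub>2_def e\<^sub>3_def)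
  define X where "X = circumcenter D E F"
  have X: "dist X D = dist X E" "dist X E = dist X F" "dist X F = dist X D"
    using dist_circumcenter[OF nc] by (simp_all add: X_def)
  have "orthocenter D E F - D = E + F - 2 *\<^sub>R X" "orthocenter D E F - E = F + D - 2 *\<^sub>R X"
    by (simp_all add: orthocenter_eq[OF nc] X_def)
  then have perp: "(orthocenter D E F - D) \<bullet> e\<^sub>1 = 0" "(orthocenter D E F - E) \<bullet> e\<^sub>2 = 0"
    using inner_sum_diff_eq_0[OF X(2)] inner_sum_diff_eq_0[OF X(3)] by (simp_all add: e\<^sub>1_def e\<^sub>2_def)
  have p: "p = 1 - q - r" using sum by simp
  have 1: "orthocenter D E F - D = r *\<^sub>R e\<^sub>2 - q *\<^sub>R e\<^sub>3"
    unfolding orth(1) p e\<^sub>2_def e\<^sub>3_def by (simp add: algebra_simps)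
  have q: "q = 1 - p - r" using sum by simp
  have 2: "orthocenter D E F - E = p *\<^sub>R e\<^sub>3 - r *\<^sub>R e\<^sub>1"
    unfolding orth(1) q e\<^sub>1_def e\<^sub>3_def by (simp add: algebra_simps)
  \<comment> \<open>The perpendicularity of two altitudes makes three such products equal.\<close>
  define k where "k = p * (e\<^sub>2 \<bullet> e\<^sub>3)"
  have k: "p * (e\<^sub>2 \<bullet> e\<^sub>3) = k" "q * (e\<^sub>3 \<bullet> e\<^sub>1) = k" "r * (e\<^sub>1 \<bullet> e\<^sub>2) = k"
    using perp unfolding 1 2 by (simp_all add: k_def inner_diff_left inner_commute[of e\<^sub>2 e\<^sub>1] inner_commute[of e\<^sub>3 e\<^sub>2])
  have "p * q * r * ((e\<^sub>2 \<bullet> e\<^sub>3) * ?g e\<^sub>1 + (e\<^sub>3 \<bullet> e\<^sub>1) * ?g e\<^sub>2 + (e\<^sub>1 \<bullet> e\<^sub>2) * ?g e\<^sub>3)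
      = (p * (e\<^sub>2 \<bullet> e\<^sub>3)) * (q * r * ?g e\<^sub>1) + (q * (e\<^sub>3 \<bullet> e\<^sub>1)) * (r * p * ?g e\<^sub>2)
        + (r * (e\<^sub>1 \<bullet> e\<^sub>2)) * (p * q * ?g e\<^sub>3)"
    by (simp add: algebra_simps)
  also have "\<dots> = k * (q * r * ?g e\<^sub>1 + r * p * ?g e\<^sub>2 + p * q * ?g e\<^sub>3)"
    unfolding k by (simp add: algebra_simps)
  finally have trace: "(e\<^sub>2 \<bullet> e\<^sub>3) * ?g e\<^sub>1 + (e\<^sub>3 \<bullet> e\<^sub>1) * ?g e\<^sub>2 + (e\<^sub>1 \<bullet> e\<^sub>2) * ?g e\<^sub>3 = 0"
    using conic pqr by simp
  \<comment> \<open>Up to sign, \<open>m\<close> is twice the area of the triangle, computed along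
    the axes. The weighted sum is minus the trace \<open>i - j\<close> of the form times
    \<open>m\<^sup>2\<close>.\<close>
  define m where "m = (e\<^sub>2 \<bullet> u) * (e\<^sub>3 \<bullet> v) - (e\<^sub>2 \<bullet> v) * (e\<^sub>3 \<bullet> u)"
  have e1: "e\<^sub>1 = - e\<^sub>2 - e\<^sub>3" by (simp add: e\<^sub>1_def e\<^sub>2_def e\<^sub>3_def)
  have "(e\<^sub>2 \<bullet> e\<^sub>3) * ?g e\<^sub>1 + (e\<^sub>3 \<bullet> e\<^sub>1) * ?g e\<^sub>2 + (e\<^sub>1 \<bullet> e\<^sub>2) * ?g e\<^sub>3 = (j - i) * m\<^sup>2"
    unfolding g orthonormal_inner_expansion[OF uv, of _ e\<^sub>1] orthonormal_inner_expansion[OF uv, of _ e\<^sub>2]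
      orthonormal_inner_expansion[OF uv, of _ e\<^sub>3] m_def
    unfolding e1 inner_diff_left inner_minus_left by algebra
  moreover have "m \<noteq> 0"
  proof
    assume "m = 0"
    then have "(e\<^sub>2 \<bullet> e\<^sub>3)\<^sup>2 = (e\<^sub>2 \<bullet> e\<^sub>2) * (e\<^sub>3 \<bullet> e\<^sub>3)"
      unfolding m_def orthonormal_inner_expansion[OF uv, of _ e\<^sub>2] orthonormal_inner_expansion[OF uv, of _ e\<^sub>3]
      by algebra
    then have "cross e\<^sub>2 e\<^sub>3 = 0" using cross_squared[of e\<^sub>2 e\<^sub>3] by simp
    then have "cross (E - D) (F - D) = 0" by (simp add: e\<^sub>2_def e\<^sub>3_def cross_def algebra_simps)
    then show False using nc by (simp add: collinear_iff_cross)
  qed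
  ultimately have "i = j" using trace by simp
  then show "a = b" using ab by (simp add: i_def j_def power2_eq_iff_nonneg)
qed

lemma is_rectangular_hyperbolaI:
  assumes "has_hyperbola_equation \<H> Z u v a a"
  shows "is_rectangular_hyperbola \<H>"
proof -
  have "u \<bullet> u = 1" "v \<bullet> v = 1" "u \<bullet> v = 0" "v \<bullet> u = 0"
    using assms by (auto simp: has_hyperbola_equation_def norm_eq_1 orthogonal_def inner_commute)
  then have "orthogonal (a *\<^sub>R u + a *\<^sub>R v) (a *\<^sub>R u - a *\<^sub>R v)"
    by (simp add: orthogonal_def inner_add_left inner_diff_right)
  then show ?thesis using assms unfolding is_rectangular_hyperbola_def by blast
qed

section \<open>The homothety onto the excentral triangle\<close>

lemma noncollinear_homothetic:
  fixes D E F :: "real^2"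
  assumes "\<not> collinear {D, E, F}"
  shows "\<not> collinear {2 *\<^sub>R D - I, 2 *\<^sub>R E - I, 2 *\<^sub>R F - I}"
  using assms by (simp add: collinear_iff_cross cross_def algebra_simps)

lemma dist_homothetic: "dist (2 *\<^sub>R P - I) (2 *\<^sub>R Q - I) = 2 * dist P (Q :: 'a::real_normed_vector)"
proof -
  have "2 *\<^sub>R P - I - (2 *\<^sub>R Q - I) = 2 *\<^sub>R (P - Q)" by (simp add: algebra_simps)
  then show ?thesis by (simp only: dist_norm) simp
qed

lemma circumcenter_homothetic:
  assumes "\<not> collinear {D, E, F}"
  shows "circumcenter (2 *\<^sub>R D - I) (2 *\<^sub>R E - I) (2 *\<^sub>R F - I) = 2 *\<^sub>R circumcenter D E F - I"
  using dist_circumcenter[OF assms]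
  by (intro circumcenter_unique noncollinear_homothetic[OF assms]) (simp_all add: dist_homothetic)

text \<open>All squared sides are multiplied by 4, so the normalized weights do not change.\<close>

lemma lemoine_point_homothetic:
  assumes nc: "\<not> collinear {D, E, F}"
  shows "lemoine_point (2 *\<^sub>R D - I) (2 *\<^sub>R E - I) (2 *\<^sub>R F - I) = 2 *\<^sub>R lemoine_point D E F - I"
proof -
  define p q r where "p = (dist E F)\<^sup>2" and "q = (dist F D)\<^sup>2" and "r = (dist D E)\<^sup>2"
  have "p > 0" "q > 0" "r > 0" using nc by (auto simp: p_def q_def r_def insert_commute)
  then have s: "p + q + r > 0" by simp
  have "lemoine_point (2 *\<^sub>R D - I) (2 *\<^sub>R E - I) (2 *\<^sub>R F - I)
      = (1 / (4 * (p + q + r))) *\<^sub>R ((4 * p) *\<^sub>R (2 *\<^sub>R D - I) + (4 * q) *\<^sub>R (2 *\<^sub>R E - I) + (4 * r) *\<^sub>R (2 *\<^sub>R F - I))"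
    unfolding lemoine_point_eq[OF noncollinear_homothetic[OF nc]] dist_homothetic
    by (simp add: p_def q_def r_def power_mult_distrib)
  also have "(4 * p) *\<^sub>R (2 *\<^sub>R D - I) + (4 * q) *\<^sub>R (2 *\<^sub>R E - I) + (4 * r) *\<^sub>R (2 *\<^sub>R F - I)
      = (4 * (p + q + r)) *\<^sub>R (2 *\<^sub>R lemoine_point D E F - I)"
  proof -
    have K: "(p + q + r) *\<^sub>R lemoine_point D E F = p *\<^sub>R D + q *\<^sub>R E + r *\<^sub>R F"
      unfolding lemoine_point_eq[OF nc] p_def[symmetric] q_def[symmetric] r_def[symmetric]
      using s by simp
    have "(4 * p) *\<^sub>R (2 *\<^sub>R D - I) + (4 * q) *\<^sub>R (2 *\<^sub>R E - I) + (4 * r) *\<^sub>R (2 *\<^sub>R F - I)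
        = 8 *\<^sub>R (p *\<^sub>R D + q *\<^sub>R E + r *\<^sub>R F) - (4 * (p + q + r)) *\<^sub>R I"
      by (simp add: algebra_simps)
    then show ?thesis
      unfolding K[symmetric] by (simp add: scaleR_diff_right)
  qed
  finally show ?thesis using s by simp
qed

section \<open>The Schiffler point on the conic, and the five incidences together\<close>

lemma (in triangle) schiffler_combination_on_circumconic:
  assumes H: "has_hyperbola_equation \<H> Z u v a b"
    and DEF: "mid_arc A B C \<in> \<H>" "mid_arc B C A \<in> \<H>" "mid_arc C A B \<in> \<H>"
    and O: "circumcenter A B C \<in> \<H>" and I: "incenter A B C \<in> \<H>"
  shows "schiffler_combination \<in> \<H>"
proof -
  define g\<^sub>1 g\<^sub>2 g\<^sub>3 where "g\<^sub>1 = hyperbola_form u v a b (mid_arc B C A - mid_arc C A B)"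
    and "g\<^sub>2 = hyperbola_form u v a b (mid_arc C A B - mid_arc A B C)"
    and "g\<^sub>3 = hyperbola_form u v a b (mid_arc A B C - mid_arc B C A)"
  note conic = circumconic_iff[OF H DEF, folded g\<^sub>1_def g\<^sub>2_def g\<^sub>3_def]
  define s n where "s = x + y + z" and "n = s * schiffler_den"
  have s: "s > 0" and n: "n > 0" using pos schiffler_den_pos by (simp_all add: s_def n_def)
  have "(z + x) / (2 * s) * ((x + y) / (2 * s)) * g\<^sub>1 + (x + y) / (2 * s) * ((y + z) / (2 * s)) * g\<^sub>2
      + (y + z) / (2 * s) * ((z + x) / (2 * s)) * g\<^sub>3 = 0"
    using O unfolding circumcenter_eq s_def[symmetric]
    by (subst (asm) conic) (use s in \<open>auto simp: s_def divide_simps\<close>)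
  then have O': "(z + x) * (x + y) * g\<^sub>1 + (x + y) * (y + z) * g\<^sub>2 + (y + z) * (z + x) * g\<^sub>3 = 0"
    using s by (simp add: divide_simps)
  have "y / s * (z / s) * g\<^sub>1 + z / s * (x / s) * g\<^sub>2 + x / s * (y / s) * g\<^sub>3 = 0"
    using I unfolding incenter_mid_arcs s_def[symmetric]
    by (subst (asm) conic) (use s in \<open>auto simp: s_def divide_simps\<close>)
  then have I': "y * z * g\<^sub>1 + z * x * g\<^sub>2 + x * y * g\<^sub>3 = 0"
    using s by (simp add: divide_simps)
  define p q r where "p = x * (y + z) * (x + 2 * y + z) * (x + y + 2 * z)"
    and "q = y * (z + x) * (2 * x + y + z) * (x + y + 2 * z)"
    and "r = z * (x + y) * (2 * x + y + z) * (x + 2 * y + z)"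
  \<comment> \<open>Up to the factor
    \<open>(2 * x + y + z) * (x + 2 * y + z) * (x + y + 2 * z)\<close>, the left side is
    \<open>2 * x * y * z\<close> times that of \<open>O'\<close> plus
    \<open>(y + z) * (z + x) * (x + y)\<close> times that of \<open>I'\<close>.\<close>
  have "q * r * g\<^sub>1 + r * p * g\<^sub>2 + p * q * g\<^sub>3 = 0"
    using O' I' unfolding p_def q_def r_def by algebra
  then have "q / n * (r / n) * g\<^sub>1 + r / n * (p / n) * g\<^sub>2 + p / n * (q / n) * g\<^sub>3 = 0"
    using n by (simp add: divide_simps)
  moreover have "p + q + r = n"
    unfolding p_def q_def r_def n_def s_def schiffler_den_def by algebra
  then have "p / n + q / n + r / n = 1"
    using n by (simp flip: add_divide_distrib)
  ultimately have "(p / n) *\<^sub>R mid_arc A B C + (q / n) *\<^sub>R mid_arc B C A + (r / n) *\<^sub>R mid_arc C A B \<in> \<H>"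
    using conic by blast
  then show ?thesis
    unfolding schiffler_combination_def p_def q_def r_def n_def s_def .
qed

theorem theorem8:
  fixes A B C D E F :: "real^2" and \<H> :: "(real^2) set"
  assumes "\<not> collinear {A, B, C}"
    and "D = mid_arc A B C" and "E = mid_arc B C A" and "F = mid_arc C A B"
    and "is_jerabek_hyperbola \<H> D E F"
  shows "is_rectangular_hyperbola \<H> \<and>
         circumcenter A B C \<in> \<H> \<and>
         incenter A B C \<in> \<H> \<and>
         midpoint (mittenpunkt A B C) (incenter A B C) \<in> \<H> \<and>
         schiffler_point A B C \<in> \<H> \<and>
         isogonal_conjugate D E F (bevan_point A B C) \<in> \<H>"
proof -
  \<comment> \<open>Semiperimeter minus the opposite side: the solution of the three side equations
    of the locale.\<close>
  define x y z where "x = (dist C A + dist A B - dist B C) / 2"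
    and "y = (dist A B + dist B C - dist C A) / 2" and "z = (dist B C + dist C A - dist A B) / 2"
  interpret triangle A B C x y z
    using assms(1) by unfold_locales (simp_all add: x_def y_def z_def field_simps)
  interpret t2: triangle B C A y z x by (rule rotate)
  interpret t3: triangle C A B z x y by (rule t2.rotate)
  note DEF = assms(2-4)
  define I where "I = incenter A B C"
  have nc: "\<not> collinear {D, E, F}" unfolding DEF by (rule noncollinear_mid_arcs)
  have circ: "circumcenter D E F = circumcenter A B C" and orth: "orthocenter D E F = I"
    unfolding DEF I_def by (rule circumcenter_mid_arcs orthocenter_mid_arcs)+
  have exc: "excenter A B C = 2 *\<^sub>R D - I" "excenter B C A = 2 *\<^sub>R E - I" "excenter C A B = 2 *\<^sub>R F - I"
    using excenter_mid_arc t2.excenter_mid_arc t3.excenter_mid_arc incenter_rotate t2.incenter_rotate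
    by (simp_all add: DEF I_def)
  have mid: "midpoint (mittenpunkt A B C) I = lemoine_point D E F"
    unfolding mittenpunkt_def exc lemoine_point_homothetic[OF nc] by (simp add: midpoint_def)
  have bevan: "bevan_point A B C = de_longchamps_point D E F"
    unfolding bevan_point_def exc circumcenter_homothetic[OF nc] de_longchamps_point_def orth ..
  have mem: "D \<in> \<H>" "E \<in> \<H>" "F \<in> \<H>" "circumcenter A B C \<in> \<H>" "I \<in> \<H>" "lemoine_point D E F \<in> \<H>"
    "isogonal_conjugate D E F (de_longchamps_point D E F) \<in> \<H>"
    using assms(5) by (simp_all add: is_jerabek_hyperbola_def circ orth)
  obtain Z u v a b where H: "has_hyperbola_equation \<H> Z u v a b"
    using assms(5) by (auto simp: is_jerabek_hyperbola_def is_hyperbola_def)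
  \<comment> \<open>The coordinates of the orthocenter \<open>I\<close> are positive: the mid-arc
    triangle is acute, so the orthocenter is not a vertex.\<close>
  have "a = b"
  proof (rule rectangular_through_orthocenter[OF H mem(1-3) nc])
    show "x / (x + y + z) + y / (x + y + z) + z / (x + y + z) = 1"
      using pos by (simp flip: add_divide_distrib)
    show "orthocenter D E F = (x / (x + y + z)) *\<^sub>R D + (y / (x + y + z)) *\<^sub>R E + (z / (x + y + z)) *\<^sub>R F"
      unfolding orth unfolding I_def DEF by (rule incenter_mid_arcs)
  qed (use pos mem orth in auto)
  then have "is_rectangular_hyperbola \<H>"
    using H is_rectangular_hyperbolaI by blast
  moreover have "schiffler_point A B C \<in> \<H>"
    unfolding schiffler_point_eq
    using schiffler_combination_on_circumconic[OF H] mem by (simp add: DEF I_def)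
  ultimately show ?thesis
    using mem mid bevan by (simp flip: I_def)
qed

end
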